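(* Let $\phi(\lambda)$ be realizable by a Buffon machine $\mathcal M$. Then the function \[ \Phi(\lambda)=\frac1\lambda\int_0^\lambda \phi(w)\,dw \] is realizable by addition of a geometric bag to $\mathcal M$. In particular, if $\phi(\lambda)$ is realizable, then its integral taken starting from $0$, namely $\lambda\mapsto\int_0^\lambda\phi(w)\,dw$, is also realizable.
   Context: A Buffon machine is a deterministic device belonging to a computationally universal class (Turing machines or, equivalently, register machines), equipped with an external source of independent uniform random bits (each call to this source is a ``flip'') and with input--output queues capable of storing integers, and which is assumed to halt with probability $1$. A function $\lambda\mapsto\phi(\lambda)$, defined for $\lambda\in(0,1)$ and with values in $(0,1)$, is weakly realizable if there is a machine $\mathcal M$ (one machine for all $\lambda$) which, when provided on its input with a perfect generator $\Gamma\mathrm B(\lambda)$ of independent Bernoulli variables of unknown parameter $\lambda$ (a source of independent $\{0,1\}$-values, each equal to $1$ with probability $\lambda$), outputs, with probability $1$, a Bernoulli random variable of parameter $\phi(\lambda)$. It is realizable if moreover the random number $C\equiv C(\lambda)$ of coin flips has finite expectation. A geometric bag is a lazily evaluated vector $U=(\upsilon_1,\upsilon_2,\dots)$ of bits, representing the binary expansion of a uniform random number $U\in[0,1]$; all the $\upsilon_j$ are initially unassigned at the start of a run. A call $bag(U)$ draws, by means of flips, $J=1+G$ with $G$ a fresh geometric variable, $\Pr(G=r)=2^{-r-1}$, $r\ge0$; if $\upsilon_J$ is unassigned, a flip is performed and its result is assigned to $\upsilon_J$; then the value of $\upsilon_J$ is returned. Thus, conditionally on $U$, $bag(U)$ is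 a Bernoulli generator of parameter $U$. Adding a geometric bag to $\mathcal M$ means replacing each call of $\mathcal M$ to $\Gamma\mathrm B(\lambda)$ by the conjunction (product) of a call to $bag(U)$ and a call to $\Gamma\mathrm B(\lambda)$, with the same bag $U$ used throughout one run.
   Formalization: As stated, finite expected flips of M with a bag can fail (von Neumann's procedure, φ=1/2). It is claimed at λ only if M's expected flips plus calls to ΓB(w) are integrable over w in (0,λ). That M with a bag outputs Bernoulli Φ(λ), and that Φ and ∫φ are realizable, is unconditional. *)

theory Defs
  imports "HOL-Probability.Probability"
begin

text \<open>
  The sources a machine can draw on. \<open>fair\<close> is the source of uniform random bits, a call to which
  is a flip; \<open>gamma\<close> is the generator of Bernoulli variables of unknown parameter. \<open>flips\<close> and
  \<open>reads\<close> count the calls made so far to the one and to the other. \<open>bag j\<close> is the bit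
  $\upsilon_j$ (\<open>j \<ge> 1\<close>) of a geometric bag, \<open>None\<close> if it is still unassigned; the bag is ignored by a
  machine without one.
\<close>

record env =
  fair :: "bool stream"
  gamma :: "bool stream"
  flips :: nat
  reads :: nat
  bag :: "nat \<Rightarrow> bool option"

definition flip :: "env \<Rightarrow> bool \<times> env" where
  "flip e = (shd (fair e), e\<lparr>fair := stl (fair e), flips := Suc (flips e)\<rparr>)"

definition gamma_call :: "env \<Rightarrow> bool \<times> env" where
  "gamma_call e = (shd (gamma e), e\<lparr>gamma := stl (gamma e), reads := Suc (reads e)\<rparr>)"

text \<open>
  A geometric variable \<open>G\<close> with $\Pr(G = r) = 2^{-r-1}$: flip until \<open>True\<close> comes up and return the
  number of \<open>False\<close> seen before it. \<open>LEAST\<close> is unspecified only on streams without any \<open>True\<close>,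
  which have probability 0.
\<close>

definition geometric_call :: "env \<Rightarrow> nat \<times> env" where
  "geometric_call e =
     (let r = (LEAST r. fair e !! r)
      in (r, e\<lparr>fair := sdrop (Suc r) (fair e), flips := flips e + Suc r\<rparr>))"

definition bag_call :: "env \<Rightarrow> bool \<times> env" where
  "bag_call e =
     (let (r, e1) = geometric_call e; j = 1 + r
      in case bag e1 j of
           Some b \<Rightarrow> (b, e1)
         | None \<Rightarrow> (let (b, e2) = flip e1 in (b, e2\<lparr>bag := (bag e2)(j \<mapsto> b)\<rparr>)))"

definition bag_gamma_call :: "env \<Rightarrow> bool \<times> env" where
  "bag_gamma_call e =
     (let (u, e1) = bag_call e; (g, e2) = gamma_call e1 in (u \<and> g, e2))"


text \<open>
  Register machines. A program is a list of instructions; it halts when the program counter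
  leaves the list. The only item on the input queue is the generator of Bernoulli variables, so
  \<open>Input r\<close> stores the result of a call to it, as 0 or 1, in register \<open>r\<close>; \<open>Output r\<close> appends the
  content of \<open>r\<close> to the output queue.
\<close>

datatype arith = Add | Sub | Mul | Div | Mod

datatype instr =
    Const nat int
  | Arith arith nat nat nat
  | JumpIfZero nat nat
  | Flip nat
  | Input nat
  | Output nat

type_synonym program = "instr list"

fun arith_op :: "arith \<Rightarrow> int \<Rightarrow> int \<Rightarrow> int" where
  "arith_op Add x y = x + y"
| "arith_op Sub x y = x - y"
| "arith_op Mul x y = x * y"
| "arith_op Div x y = x div y"
| "arith_op Mod x y = x mod y"

record config =
  pc :: nat
  regs :: "nat \<Rightarrow> int"
  outq :: "int list"
  env :: env

text \<open>
  The parameter \<open>src\<close> is the procedure executed for each call to the Bernoulli generator: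
  \<open>gamma_call\<close> gives the machine \<open>P\<close> itself, \<open>bag_gamma_call\<close> gives the machine obtained by adding
  a geometric bag to \<open>P\<close>.
\<close>

fun exec :: "(env \<Rightarrow> bool \<times> env) \<Rightarrow> instr \<Rightarrow> config \<Rightarrow> config" where
  "exec src (Const r k) c = c\<lparr>pc := Suc (pc c), regs := (regs c)(r := k)\<rparr>"
| "exec src (Arith f r a b) c =
     c\<lparr>pc := Suc (pc c), regs := (regs c)(r := arith_op f (regs c a) (regs c b))\<rparr>"
| "exec src (JumpIfZero r l) c = c\<lparr>pc := (if regs c r = 0 then l else Suc (pc c))\<rparr>"
| "exec src (Flip r) c =
     (let (b, e) = flip (env c)
      in c\<lparr>pc := Suc (pc c), regs := (regs c)(r := of_bool b), env := e\<rparr>)"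
| "exec src (Input r) c =
     (let (b, e) = src (env c)
      in c\<lparr>pc := Suc (pc c), regs := (regs c)(r := of_bool b), env := e\<rparr>)"
| "exec src (Output r) c = c\<lparr>pc := Suc (pc c), outq := outq c @ [regs c r]\<rparr>"

definition halted :: "program \<Rightarrow> config \<Rightarrow> bool" where
  "halted P c \<longleftrightarrow> length P \<le> pc c"

definition step :: "(env \<Rightarrow> bool \<times> env) \<Rightarrow> program \<Rightarrow> config \<Rightarrow> config" where
  "step src P c = (if halted P c then c else exec src (P ! pc c) c)"

text \<open>A sample \<open>\<omega>\<close> is the pair of the bits delivered by \<open>fair\<close> and those delivered by \<open>gamma\<close>.\<close>

definition init :: "bool stream \<times> bool stream \<Rightarrow> config" where
  "init \<omega> = \<lparr>pc = 0, regs = (\<lambda>_. 0), outq = [],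
     env = \<lparr>fair = fst \<omega>, gamma = snd \<omega>, flips = 0, reads = 0, bag = (\<lambda>_. None)\<rparr>\<rparr>"

definition run ::
  "(env \<Rightarrow> bool \<times> env) \<Rightarrow> program \<Rightarrow> bool stream \<times> bool stream \<Rightarrow> nat \<Rightarrow> config" where
  "run src P \<omega> n = (step src P ^^ n) (init \<omega>)"

definition outputs ::
  "(env \<Rightarrow> bool \<times> env) \<Rightarrow> program \<Rightarrow> bool stream \<times> bool stream \<Rightarrow> int list \<Rightarrow> bool" where
  "outputs src P \<omega> xs \<longleftrightarrow> (\<exists>n. halted P (run src P \<omega> n) \<and> outq (run src P \<omega> n) = xs)"

definition samples :: "real \<Rightarrow> (bool stream \<times> bool stream) measure" where
  "samples l = stream_space (measure_pmf (bernoulli_pmf (1/2)))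
           \<Otimes>\<^sub>M stream_space (measure_pmf (bernoulli_pmf l))"

definition expected_flips :: "(env \<Rightarrow> bool \<times> env) \<Rightarrow> program \<Rightarrow> real \<Rightarrow> ennreal" where
  "expected_flips src P l =
     (\<integral>\<^sup>+ \<omega>. (SUP n. ennreal (real (flips (env (run src P \<omega> n))))) \<partial>samples l)"

definition expected_reads :: "(env \<Rightarrow> bool \<times> env) \<Rightarrow> program \<Rightarrow> real \<Rightarrow> ennreal" where
  "expected_reads src P l =
     (\<integral>\<^sup>+ \<omega>. (SUP n. ennreal (real (reads (env (run src P \<omega> n))))) \<partial>samples l)"


text \<open>Only the values of \<open>\<phi>\<close> on the open unit interval matter.\<close>

definition weakly_realizes ::
  "(env \<Rightarrow> bool \<times> env) \<Rightarrow> program \<Rightarrow> (real \<Rightarrow> real) \<Rightarrow> bool" where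
  "weakly_realizes src P \<phi> \<longleftrightarrow>
     (\<forall>l\<in>{0<..<1}.
        \<phi> l \<in> {0<..<1} \<and>
        (AE \<omega> in samples l. \<exists>b. outputs src P \<omega> [of_bool b]) \<and>
        measure (samples l) {\<omega> \<in> space (samples l). outputs src P \<omega> [1]} = \<phi> l)"

definition realizes ::
  "(env \<Rightarrow> bool \<times> env) \<Rightarrow> program \<Rightarrow> (real \<Rightarrow> real) \<Rightarrow> bool" where
  "realizes src P \<phi> \<longleftrightarrow>
     weakly_realizes src P \<phi> \<and> (\<forall>l\<in>{0<..<1}. expected_flips src P l < \<infinity>)"

definition realizable :: "(real \<Rightarrow> real) \<Rightarrow> bool" where
  "realizable \<phi> \<longleftrightarrow> (\<exists>P. realizes gamma_call P \<phi>)"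

end

theory Submission
  imports Defs
begin

text \<open>
  Condition on the number $U$ whose binary digits the bag holds. Every call to the modified source is
  then answered by an independent Bernoulli variable of parameter $U\lambda$, so the machine with a bag
  behaves as \<open>M\<close> does at the parameter $U\lambda$, and the average of $\phi(U\lambda)$ over a uniform $U$ is
  $\frac1\lambda\int_0^\lambda\phi$. Because the digits are assigned lazily, the conditioning is carried
  out one call at a time. A state \<open>\<beta>\<close> of the bag stands for a $U$ that is uniform on the set \<open>agree \<beta>\<close> of
  the numbers with the digits assigned so far. Lemma \<open>bag_payoff_weight\<close> says that whatever the machine
  with a bag achieves in $n$ steps from \<open>\<beta>\<close> is the average over \<open>agree \<beta>\<close> of what \<open>M\<close> achieves at the
  parameter $U\lambda$. Its induction step rests on two facts: a digit read at a random position $J$ with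
  $\Pr(J=j)=2^{-j}$ has mean $\sum_j 2^{-j}u_j=U$, and an unassigned digit cuts \<open>agree \<beta>\<close> into two halves
  of equal measure.

  ``What a machine achieves'' is a \<open>payoff\<close>, computed by recursion along the execution: its terminal value
  and its costs per call can be chosen so that it is an output probability or an expected number of
  calls. Lemmas \<open>gamma_payoff\<close> and \<open>bag_gamma_payoff\<close> identify payoffs with integrals over the bit
  streams. One call to the bag costs at most three flips on average, so the same averaging bounds
  the expected number of flips of the machine with a bag by
  $\frac3\lambda\int_0^\lambda$ of the flips and reads of \<open>M\<close>.

  Realizability asks for finitely many flips on average, and that integral may diverge. However, the
  generator of unknown parameter is itself a source of fair bits: of two calls with different answers,
  either one is equally likely to have come first. Hence the machine with a bag can be emulated by a
  program that never flips at all, which keeps the bag in the ternary digits of one register. To see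
  that this emulator has the right output distribution it suffices to bound its probabilities of
  printing 1 and of printing 0 from below by those of the machine with a bag, since the latter add up to
  1 (\<open>realizesI_lower_bounds\<close>); the lower bounds follow by induction on the number of emulated steps
  (\<open>emulation\<close>). A single additional call to the generator in front of the emulator multiplies the
  function by $\lambda$, which gives the integral itself.
\<close>

section \<open>Draws from the bit streams\<close>

text \<open>
  The expectation of \<open>f\<close> at a Bernoulli variable of parameter \<open>p\<close>. Written as a polynomial in \<open>p\<close>, it is
  measurable in \<open>p\<close> without any condition on the range, as needed for integrating over the parameter.
\<close>

definition mix :: "real \<Rightarrow> (bool \<Rightarrow> ennreal) \<Rightarrow> ennreal" where
  "mix p f = ennreal p * f True + ennreal (1 - p) * f False"

lemma mix_mono: "(\<And>b. f b \<le> g b) \<Longrightarrow> mix p f \<le> mix p g"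
  unfolding mix_def by (intro add_mono mult_left_mono) auto

lemma mix_add: "mix p (\<lambda>b. f b + g b) = mix p f + mix p g"
  unfolding mix_def by (simp add: distrib_left ac_simps)

lemma mix_const: "0 \<le> p \<Longrightarrow> p \<le> 1 \<Longrightarrow> mix p (\<lambda>_. c) = c"
  unfolding mix_def distrib_right[symmetric] by (simp add: ennreal_plus[symmetric] del: ennreal_plus)

lemma mix_SUP:
  assumes "\<And>b. incseq (\<lambda>n. f n b)"
  shows "mix p (\<lambda>b. SUP n. f n b) = (SUP n. mix p (f n))"
proof -
  have m: "incseq (\<lambda>n. c * f n b)" for c b
    using assms[of b] by (auto simp: incseq_def intro!: mult_left_mono)
  show ?thesis unfolding mix_def
    by (simp add: SUP_mult_left_ennreal ennreal_SUP_add[OF m m])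
qed

lemma measurable_mix[measurable]:
  assumes [measurable]: "\<And>b. (\<lambda>x. f x b) \<in> borel_measurable N" "p \<in> borel_measurable N"
  shows "(\<lambda>x. mix (p x) (f x)) \<in> borel_measurable N"
  unfolding mix_def by measurable

definition coins :: "real \<Rightarrow> bool stream measure" where
  "coins p = stream_space (measure_pmf (bernoulli_pmf p))"

lemma samples_coins: "samples p = coins (1/2) \<Otimes>\<^sub>M coins p"
  by (simp add: samples_def coins_def)

lemma prob_space_coins: "prob_space (coins p)"
  unfolding coins_def by (rule prob_space.prob_space_stream_space) (rule prob_space_measure_pmf)

lemma prob_space_samples: "prob_space (samples p)"
proof -
  interpret A: prob_space "coins (1/2)" by (rule prob_space_coins)
  interpret B: prob_space "coins p" by (rule prob_space_coins)
  interpret pair_prob_space "coins (1/2)" "coins p" ..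
  show ?thesis unfolding samples_coins by unfold_locales
qed

lemma space_samples[simp]: "space (samples p) = UNIV"
  by (simp add: samples_def space_pair_measure space_stream_space)

lemma measurable_coins_shd[measurable]: "shd \<in> coins p \<rightarrow>\<^sub>M count_space UNIV"
  unfolding coins_def by (rule measurable_compose[OF measurable_shd]) simp

lemma measurable_coins_stl[measurable]: "stl \<in> coins p \<rightarrow>\<^sub>M coins p"
  unfolding coins_def by (rule measurable_stl)

lemma measurable_coins_sdrop[measurable]: "sdrop n \<in> coins p \<rightarrow>\<^sub>M coins p"
  unfolding coins_def by (rule measurable_sdrop)

lemma measurable_coins_snth[measurable]: "(\<lambda>s. s !! n) \<in> coins p \<rightarrow>\<^sub>M count_space UNIV"
  unfolding coins_def by (rule measurable_compose[OF measurable_snth]) simp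

lemma nn_integral_coins:
  assumes [measurable]: "f \<in> borel_measurable (coins p)" and p: "0 \<le> p" "p \<le> 1"
  shows "(\<integral>\<^sup>+ s. f s \<partial>coins p) = mix p (\<lambda>b. \<integral>\<^sup>+ s. f (b ## s) \<partial>coins p)"
  using prob_space.nn_integral_stream_space[OF prob_space_measure_pmf, of f "bernoulli_pmf p"] assms
  by (simp add: coins_def mix_def mult.commute)

text \<open>
  Each draw from the streams selects one of countably many continuations, each of them measurable.
\<close>

lemma measurable_choice:
  fixes h :: "'i::countable \<Rightarrow> 'a \<Rightarrow> 'b"
  assumes "\<And>i. h i \<in> M \<rightarrow>\<^sub>M N" "k \<in> M \<rightarrow>\<^sub>M count_space UNIV"
  shows "(\<lambda>x. h (k x) x) \<in> M \<rightarrow>\<^sub>M N"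
  by (rule measurable_compose_countable[OF assms])

lemma measurable_draw_fair:
  fixes h :: "bool \<Rightarrow> bool stream \<times> bool stream \<Rightarrow> ennreal"
  assumes [measurable]: "\<And>b. h b \<in> borel_measurable (samples p)"
  shows "(\<lambda>\<omega>. h (shd (fst \<omega>)) (stl (fst \<omega>), snd \<omega>)) \<in> borel_measurable (samples p)"
proof -
  have "(\<lambda>\<omega>. (stl (fst \<omega>), snd \<omega>)) \<in> samples p \<rightarrow>\<^sub>M samples p"
    unfolding samples_coins by measurable
  then have "(\<lambda>\<omega>. h b (stl (fst \<omega>), snd \<omega>)) \<in> borel_measurable (samples p)" for b
    by measurable
  moreover have "(\<lambda>\<omega>. shd (fst \<omega>)) \<in> samples p \<rightarrow>\<^sub>M count_space UNIV"
    unfolding samples_coins by measurable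
  ultimately show ?thesis by (rule measurable_choice)
qed

lemma measurable_draw_gamma:
  fixes h :: "bool \<Rightarrow> bool stream \<times> bool stream \<Rightarrow> ennreal"
  assumes [measurable]: "\<And>b. h b \<in> borel_measurable (samples p)"
  shows "(\<lambda>\<omega>. h (shd (snd \<omega>)) (fst \<omega>, stl (snd \<omega>))) \<in> borel_measurable (samples p)"
proof -
  have "(\<lambda>\<omega>. (fst \<omega>, stl (snd \<omega>))) \<in> samples p \<rightarrow>\<^sub>M samples p"
    unfolding samples_coins by measurable
  then have "(\<lambda>\<omega>. h b (fst \<omega>, stl (snd \<omega>))) \<in> borel_measurable (samples p)" for b
    by measurable
  moreover have "(\<lambda>\<omega>. shd (snd \<omega>)) \<in> samples p \<rightarrow>\<^sub>M count_space UNIV"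
    unfolding samples_coins by measurable
  ultimately show ?thesis by (rule measurable_choice)
qed

text \<open>
  The head of a stream of independent bits is independent of its tail, and the tail has the law of the
  whole stream. What remains after a draw is therefore again a sample, which makes recursion along the
  execution of a machine possible.
\<close>

lemma nn_integral_draw_fair:
  fixes h :: "bool \<Rightarrow> bool stream \<times> bool stream \<Rightarrow> ennreal"
  assumes h: "\<And>b. h b \<in> borel_measurable (samples p)"
  shows "(\<integral>\<^sup>+ \<omega>. h (shd (fst \<omega>)) (stl (fst \<omega>), snd \<omega>) \<partial>samples p)
    = mix (1/2) (\<lambda>b. \<integral>\<^sup>+ \<omega>. h b \<omega> \<partial>samples p)"
proof -
  interpret B: prob_space "coins p" by (rule prob_space_coins)
  have h'[measurable]: "h b \<in> borel_measurable (coins (1/2) \<Otimes>\<^sub>M coins p)" for b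
    using h by (simp add: samples_coins)
  have "(\<integral>\<^sup>+ \<omega>. h (shd (fst \<omega>)) (stl (fst \<omega>), snd \<omega>) \<partial>samples p)
      = (\<integral>\<^sup>+ s. \<integral>\<^sup>+ t. h (shd s) (stl s, t) \<partial>coins p \<partial>coins (1/2))"
    unfolding samples_coins
    by (subst B.nn_integral_fst[symmetric])
      (use measurable_draw_fair[OF h] in \<open>simp_all add: samples_coins\<close>)
  also have "\<dots> = mix (1/2) (\<lambda>b. \<integral>\<^sup>+ s. \<integral>\<^sup>+ t. h b (s, t) \<partial>coins p \<partial>coins (1/2))"
  proof (subst nn_integral_coins)
    have "(\<lambda>s. \<integral>\<^sup>+ t. h b (stl s, t) \<partial>coins p) \<in> borel_measurable (coins (1/2))" for b
      by measurable
    then show "(\<lambda>s. \<integral>\<^sup>+ t. h (shd s) (stl s, t) \<partial>coins p) \<in> borel_measurable (coins (1/2))"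
      by (rule measurable_choice) measurable
  qed simp_all
  also have "\<dots> = mix (1/2) (\<lambda>b. \<integral>\<^sup>+ \<omega>. h b \<omega> \<partial>samples p)"
    by (simp add: samples_coins B.nn_integral_fst)
  finally show ?thesis .
qed

lemma nn_integral_draw_gamma:
  fixes h :: "bool \<Rightarrow> bool stream \<times> bool stream \<Rightarrow> ennreal"
  assumes h: "\<And>b. h b \<in> borel_measurable (samples p)" and p: "0 \<le> p" "p \<le> 1"
  shows "(\<integral>\<^sup>+ \<omega>. h (shd (snd \<omega>)) (fst \<omega>, stl (snd \<omega>)) \<partial>samples p)
    = mix p (\<lambda>b. \<integral>\<^sup>+ \<omega>. h b \<omega> \<partial>samples p)"
proof -
  interpret A: prob_space "coins (1/2)" by (rule prob_space_coins)
  interpret B: prob_space "coins p" by (rule prob_space_coins)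
  interpret pair_sigma_finite "coins (1/2)" "coins p" ..
  have h'[measurable]: "h b \<in> borel_measurable (coins (1/2) \<Otimes>\<^sub>M coins p)" for b
    using h by (simp add: samples_coins)
  have "(\<integral>\<^sup>+ \<omega>. h (shd (snd \<omega>)) (fst \<omega>, stl (snd \<omega>)) \<partial>samples p)
      = (\<integral>\<^sup>+ t. \<integral>\<^sup>+ s. h (shd t) (s, stl t) \<partial>coins (1/2) \<partial>coins p)"
    unfolding samples_coins
    by (subst nn_integral_snd[symmetric])
      (use measurable_draw_gamma[OF h] in \<open>simp_all add: samples_coins split_beta\<close>)
  also have "\<dots> = mix p (\<lambda>b. \<integral>\<^sup>+ t. \<integral>\<^sup>+ s. h b (s, t) \<partial>coins (1/2) \<partial>coins p)"
  proof (subst nn_integral_coins)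
    have "(\<lambda>t. \<integral>\<^sup>+ s. h b (s, stl t) \<partial>coins (1/2)) \<in> borel_measurable (coins p)" for b
      by measurable
    then show "(\<lambda>t. \<integral>\<^sup>+ s. h (shd t) (s, stl t) \<partial>coins (1/2)) \<in> borel_measurable (coins p)"
      by (rule measurable_choice) measurable
  qed (use p in simp_all)
  also have "\<dots> = mix p (\<lambda>b. \<integral>\<^sup>+ \<omega>. h b \<omega> \<partial>samples p)"
    by (simp add: samples_coins nn_integral_snd)
  finally show ?thesis .
qed

definition first_at :: "nat \<Rightarrow> bool stream \<Rightarrow> bool" where
  "first_at r s \<longleftrightarrow> s !! r \<and> (\<forall>i<r. \<not> s !! i)"

lemma first_at_0: "first_at 0 s \<longleftrightarrow> shd s"
  by (simp add: first_at_def)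

lemma first_at_Suc: "first_at (Suc r) s \<longleftrightarrow> \<not> shd s \<and> first_at r (stl s)"
  unfolding first_at_def All_less_Suc2 by auto

lemma first_at_Least: "first_at r s \<Longrightarrow> (LEAST i. s !! i) = r"
  unfolding first_at_def by (intro Least_equality) (auto simp: not_less[symmetric])

lemma measurable_first_at[measurable]: "Measurable.pred (coins p) (first_at r)"
  unfolding first_at_def by measurable

lemma measurable_sdrop_fair:
  "(\<lambda>\<omega>. (sdrop n (fst \<omega>), snd \<omega>)) \<in> samples p \<rightarrow>\<^sub>M samples p"
  unfolding samples_coins
  by (rule measurable_Pair[OF measurable_compose[OF measurable_fst measurable_coins_sdrop] measurable_snd])

text \<open>
  Fixing the first \<open>Suc r\<close> flips leaves a fresh sample; the induction peels off one flip at a time.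
\<close>

lemma nn_integral_first_at:
  fixes h :: "bool stream \<times> bool stream \<Rightarrow> ennreal"
  assumes [measurable]: "h \<in> borel_measurable (samples p)"
  shows "(\<integral>\<^sup>+ \<omega>. indicator {s. first_at r s} (fst \<omega>) * h (sdrop (Suc r) (fst \<omega>), snd \<omega>) \<partial>samples p)
    = ennreal ((1/2) ^ Suc r) * (\<integral>\<^sup>+ \<omega>. h \<omega> \<partial>samples p)"
proof (induction r)
  case 0
  have "(\<integral>\<^sup>+ \<omega>. indicator {s. first_at 0 s} (fst \<omega>) * h (sdrop (Suc 0) (fst \<omega>), snd \<omega>) \<partial>samples p)
      = (\<integral>\<^sup>+ \<omega>. of_bool (shd (fst \<omega>)) * h (stl (fst \<omega>), snd \<omega>) \<partial>samples p)"
    by (intro nn_integral_cong) (simp add: first_at_0 indicator_def)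
  also have "\<dots> = mix (1/2) (\<lambda>b. \<integral>\<^sup>+ \<omega>. of_bool b * h \<omega> \<partial>samples p)"
    by (rule nn_integral_draw_fair[where h = "\<lambda>b \<omega>. of_bool b * h \<omega>"]) measurable
  finally show ?case by (simp add: mix_def)
next
  case (Suc r)
  define g where "g \<omega> = indicator {s. first_at r s} (fst \<omega>) * h (sdrop (Suc r) (fst \<omega>), snd \<omega>)" for \<omega>
  have [measurable]: "(\<lambda>\<omega>. (sdrop (Suc r) (fst \<omega>), snd \<omega>)) \<in> samples p \<rightarrow>\<^sub>M samples p"
    by (rule measurable_sdrop_fair)
  have [measurable]: "(\<lambda>\<omega>. indicator {s. first_at r s} (fst \<omega>) :: ennreal) \<in> borel_measurable (samples p)"
    unfolding samples_coins by measurable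
  have [measurable]: "g \<in> borel_measurable (samples p)"
    unfolding g_def by measurable
  have "(\<integral>\<^sup>+ \<omega>. indicator {s. first_at (Suc r) s} (fst \<omega>)
          * h (sdrop (Suc (Suc r)) (fst \<omega>), snd \<omega>) \<partial>samples p)
      = (\<integral>\<^sup>+ \<omega>. of_bool (\<not> shd (fst \<omega>)) * g (stl (fst \<omega>), snd \<omega>) \<partial>samples p)"
    by (intro nn_integral_cong) (simp add: first_at_Suc indicator_def g_def)
  also have "\<dots> = mix (1/2) (\<lambda>b. \<integral>\<^sup>+ \<omega>. of_bool (\<not> b) * g \<omega> \<partial>samples p)"
    by (rule nn_integral_draw_fair[where h = "\<lambda>b \<omega>. of_bool (\<not> b) * g \<omega>"]) measurable
  also have "\<dots> = ennreal (1/2) * (\<integral>\<^sup>+ \<omega>. g \<omega> \<partial>samples p)"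
    by (simp add: mix_def)
  also have "\<dots> = ennreal (1/2) * (ennreal ((1/2) ^ Suc r) * (\<integral>\<^sup>+ \<omega>. h \<omega> \<partial>samples p))"
    using Suc by (simp add: g_def)
  also have "\<dots> = ennreal ((1/2) ^ Suc (Suc r)) * (\<integral>\<^sup>+ \<omega>. h \<omega> \<partial>samples p)"
    unfolding mult.assoc[symmetric] by (subst ennreal_mult[symmetric]) simp_all
  finally show ?case .
qed

lemma suminf_half_powers: "(\<Sum>r. ennreal ((1/2) ^ Suc r)) = 1"
  by (subst suminf_ennreal_eq[OF _ power_half_series]) (auto intro: zero_le_power)

text \<open>
  The events for different \<open>r\<close> are disjoint, and their probabilities $2^{-r-1}$ add up to 1.
\<close>

lemma AE_first_at: "AE \<omega> in samples p. (\<exists>r. first_at r (fst \<omega>))"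
proof -
  interpret prob_space "samples p" by (rule prob_space_samples)
  have [measurable]: "Measurable.pred (samples p) (\<lambda>\<omega>. first_at r (fst \<omega>))" for r
    unfolding samples_coins by measurable
  have sets: "{\<omega>. first_at r (fst \<omega>)} \<in> sets (samples p)" for r
  proof -
    have "{\<omega> \<in> space (samples p). first_at r (fst \<omega>)} \<in> sets (samples p)" by measurable
    then show ?thesis by simp
  qed
  have e: "emeasure (samples p) {\<omega>. first_at r (fst \<omega>)} = ennreal ((1/2) ^ Suc r)" for r
  proof -
    have "emeasure (samples p) {\<omega>. first_at r (fst \<omega>)}
        = (\<integral>\<^sup>+ \<omega>. indicator {\<omega>. first_at r (fst \<omega>)} \<omega> \<partial>samples p)"
      using sets by simp
    also have "\<dots> = (\<integral>\<^sup>+ \<omega>. indicator {s. first_at r s} (fst \<omega>) * 1 \<partial>samples p)"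
      by (intro nn_integral_cong) (simp add: indicator_def)
    also have "\<dots> = ennreal ((1/2) ^ Suc r) * (\<integral>\<^sup>+ \<omega>. 1 \<partial>samples p)"
      by (rule nn_integral_first_at) simp
    finally show ?thesis by (simp add: emeasure_space_1[unfolded space_samples])
  qed
  have "disjoint_family (\<lambda>r. {\<omega>::bool stream \<times> bool stream. first_at r (fst \<omega>)})"
    by (auto simp: disjoint_family_on_def dest: first_at_Least)
  then have "emeasure (samples p) (\<Union>r. {\<omega>. first_at r (fst \<omega>)}) = 1"
    by (subst suminf_emeasure[symmetric]) (use sets in \<open>auto simp: e suminf_half_powers simp del: power_Suc\<close>)
  then have "AE \<omega> in samples p. \<omega> \<in> (\<Union>r. {\<omega>. first_at r (fst \<omega>)})"
    by (subst AE_iff_emeasure_eq_1) (use sets in \<open>auto simp: Collect_ex_eq[symmetric]\<close>)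
  then show ?thesis by auto
qed

lemma measurable_draw_geometric:
  fixes h :: "nat \<Rightarrow> bool stream \<times> bool stream \<Rightarrow> ennreal"
  assumes [measurable]: "\<And>r. h r \<in> borel_measurable (samples p)"
  shows "(\<lambda>\<omega>. h (LEAST r. fst \<omega> !! r) (sdrop (Suc (LEAST r. fst \<omega> !! r)) (fst \<omega>), snd \<omega>))
    \<in> borel_measurable (samples p)"
proof -
  have "(\<lambda>\<omega>. h r (sdrop (Suc r) (fst \<omega>), snd \<omega>)) \<in> borel_measurable (samples p)" for r
    using measurable_sdrop_fair[of "Suc r" p] by measurable
  moreover have "(\<lambda>\<omega>. LEAST r. fst \<omega> !! r) \<in> samples p \<rightarrow>\<^sub>M count_space UNIV"
    unfolding samples_coins by measurable
  ultimately show ?thesis by (rule measurable_choice)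
qed

text \<open>
  Splitting according to the value of the geometric variable reduces this to events that fix finitely
  many flips; outside of these events lies a null set, on which \<open>LEAST\<close> is unspecified.
\<close>

lemma nn_integral_draw_geometric:
  fixes h :: "nat \<Rightarrow> bool stream \<times> bool stream \<Rightarrow> ennreal"
  assumes [measurable]: "\<And>r. h r \<in> borel_measurable (samples p)"
  shows "(\<integral>\<^sup>+ \<omega>. h (LEAST r. fst \<omega> !! r) (sdrop (Suc (LEAST r. fst \<omega> !! r)) (fst \<omega>), snd \<omega>) \<partial>samples p)
    = (\<Sum>r. ennreal ((1/2) ^ Suc r) * (\<integral>\<^sup>+ \<omega>. h r \<omega> \<partial>samples p))"
proof -
  have [measurable]: "(\<lambda>\<omega>. indicator {s. first_at r s} (fst \<omega>) * h r (sdrop (Suc r) (fst \<omega>), snd \<omega>))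
      \<in> borel_measurable (samples p)" for r
  proof -
    have [measurable]: "(\<lambda>\<omega>. indicator {s. first_at r s} (fst \<omega>) :: ennreal) \<in> borel_measurable (samples p)"
      unfolding samples_coins by measurable
    show ?thesis using measurable_sdrop_fair[of "Suc r" p] by measurable
  qed
  have "(\<integral>\<^sup>+ \<omega>. h (LEAST r. fst \<omega> !! r) (sdrop (Suc (LEAST r. fst \<omega> !! r)) (fst \<omega>), snd \<omega>) \<partial>samples p)
      = (\<integral>\<^sup>+ \<omega>. (\<Sum>r. indicator {s. first_at r s} (fst \<omega>) * h r (sdrop (Suc r) (fst \<omega>), snd \<omega>)) \<partial>samples p)"
    using AE_first_at
  proof (intro nn_integral_cong_AE, eventually_elim)
    case (elim \<omega>)
    then obtain r0 where r0: "first_at r0 (fst \<omega>)" by auto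
    then have "(LEAST r. fst \<omega> !! r) = r0" by (rule first_at_Least)
    moreover have "(\<Sum>r. indicator {s. first_at r s} (fst \<omega>) * h r (sdrop (Suc r) (fst \<omega>), snd \<omega>))
        = h r0 (sdrop (Suc r0) (fst \<omega>), snd \<omega>)"
    proof (subst suminf_finite[of "{r0}"])
      fix r assume "r \<notin> {r0}"
      then have "\<not> first_at r (fst \<omega>)" using r0 first_at_Least by blast
      then show "indicator {s. first_at r s} (fst \<omega>) * h r (sdrop (Suc r) (fst \<omega>), snd \<omega>) = 0" by simp
    qed (use r0 in auto)
    ultimately show ?case by simp
  qed
  also have "\<dots> = (\<Sum>r. \<integral>\<^sup>+ \<omega>. indicator {s. first_at r s} (fst \<omega>)
      * h r (sdrop (Suc r) (fst \<omega>), snd \<omega>) \<partial>samples p)"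
    by (rule nn_integral_suminf) measurable
  also have "\<dots> = (\<Sum>r. ennreal ((1/2) ^ Suc r) * (\<integral>\<^sup>+ \<omega>. h r \<omega> \<partial>samples p))"
    by (subst nn_integral_first_at) auto
  finally show ?thesis .
qed

section \<open>Expected payoff after finitely many steps\<close>

text \<open>
  A configuration without its environment: program counter, registers and output queue.
\<close>

type_synonym mem = "nat \<times> (nat \<Rightarrow> int) \<times> int list"

text \<open>
  One step of a machine, as a function of its own state alone, with the random bit it may ask for left
  open. Since the source of that bit does not occur here, the same program can be run against different
  sources by choosing how \<open>Query\<close> is answered.
\<close>

datatype node = Done | Quiet mem | Coin "bool \<Rightarrow> mem" | Query "bool \<Rightarrow> mem"

fun node_of :: "program \<Rightarrow> mem \<Rightarrow> node" where
  "node_of P (i, R, q) =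
     (if length P \<le> i then Done
      else case P ! i of
          Const r k \<Rightarrow> Quiet (Suc i, R(r := k), q)
        | Arith f r x y \<Rightarrow> Quiet (Suc i, R(r := arith_op f (R x) (R y)), q)
        | JumpIfZero r l \<Rightarrow> Quiet (if R r = 0 then l else Suc i, R, q)
        | Flip r \<Rightarrow> Coin (\<lambda>b. (Suc i, R(r := of_bool b), q))
        | Input r \<Rightarrow> Query (\<lambda>b. (Suc i, R(r := of_bool b), q))
        | Output r \<Rightarrow> Quiet (Suc i, R, q @ [R r]))"

definition cfg :: "mem \<Rightarrow> env \<Rightarrow> config" where
  "cfg m e = \<lparr>pc = fst m, regs = fst (snd m), outq = snd (snd m), env = e\<rparr>"

definition world ::
  "bool stream \<times> bool stream \<Rightarrow> nat \<Rightarrow> nat \<Rightarrow> (nat \<Rightarrow> bool option) \<Rightarrow> env" where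
  "world \<omega> f r \<beta> = \<lparr>fair = fst \<omega>, gamma = snd \<omega>, flips = f, reads = r, bag = \<beta>\<rparr>"

lemma step_cfg:
  "step src P (cfg m e) =
     (case node_of P m of
        Done \<Rightarrow> cfg m e
      | Quiet m' \<Rightarrow> cfg m' e
      | Coin k \<Rightarrow> cfg (k (fst (flip e))) (snd (flip e))
      | Query k \<Rightarrow> cfg (k (fst (src e))) (snd (src e)))"
  by (cases m; cases "P ! fst m") (auto simp: step_def halted_def cfg_def split_beta)

lemma flip_world:
  "flip (world \<omega> f r \<beta>) = (shd (fst \<omega>), world (stl (fst \<omega>), snd \<omega>) (Suc f) r \<beta>)"
  by (simp add: flip_def world_def)

lemma gamma_call_world:
  "gamma_call (world \<omega> f r \<beta>) = (shd (snd \<omega>), world (fst \<omega>, stl (snd \<omega>)) f (Suc r) \<beta>)"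
  by (simp add: gamma_call_def world_def)

lemma bag_gamma_call_world:
  "bag_gamma_call (world \<omega> f r \<beta>) =
     (let R = (LEAST i. fst \<omega> !! i); \<omega>' = (sdrop (Suc R) (fst \<omega>), snd \<omega>)
      in case \<beta> (Suc R) of
           Some u \<Rightarrow> (u \<and> shd (snd \<omega>'), world (fst \<omega>', stl (snd \<omega>')) (f + Suc R) (Suc r) \<beta>)
         | None \<Rightarrow> (let u = shd (fst \<omega>'); \<omega>'' = (stl (fst \<omega>'), snd \<omega>')
             in (u \<and> shd (snd \<omega>''),
                 world (fst \<omega>'', stl (snd \<omega>'')) (Suc (f + Suc R)) (Suc r) (\<beta>(Suc R \<mapsto> u)))))"
  by (simp add: bag_gamma_call_def bag_call_def geometric_call_def gamma_call_def flip_def world_def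
      Let_def split_beta split: option.split)

text \<open>
  The quantity to be averaged, with price \<open>a\<close> per flip, price \<open>b\<close> per read and terminal value \<open>\<tau>\<close>. An
  indicator \<open>\<tau>\<close> at price 0 yields output probabilities; \<open>\<tau> = 0\<close> and price 1 yield expected numbers of
  calls.
\<close>

definition score :: "ennreal \<Rightarrow> ennreal \<Rightarrow> (mem \<Rightarrow> ennreal) \<Rightarrow> config \<Rightarrow> ennreal" where
  "score a b \<tau> c = a * of_nat (flips (env c)) + b * of_nat (reads (env c)) + \<tau> (pc c, regs c, outq c)"

lemma score_cfg_world:
  "score a b \<tau> (cfg m (world \<omega> f r \<beta>)) = a * of_nat f + b * of_nat r + \<tau> m"
  by (simp add: score_def cfg_def world_def)

text \<open>
  The expectation of the score that is collected in \<open>n\<close> steps from \<open>m\<close> when the generator has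
  parameter \<open>p\<close>.
\<close>

primrec payoff ::
  "program \<Rightarrow> (mem \<Rightarrow> ennreal) \<Rightarrow> ennreal \<Rightarrow> ennreal \<Rightarrow> real \<Rightarrow> nat \<Rightarrow> mem \<Rightarrow> ennreal" where
  "payoff P \<tau> a b p 0 m = \<tau> m"
| "payoff P \<tau> a b p (Suc n) m =
     (case node_of P m of
        Done \<Rightarrow> \<tau> m
      | Quiet m' \<Rightarrow> payoff P \<tau> a b p n m'
      | Coin k \<Rightarrow> a + mix (1/2) (\<lambda>x. payoff P \<tau> a b p n (k x))
      | Query k \<Rightarrow> b + mix p (\<lambda>x. payoff P \<tau> a b p n (k x)))"

text \<open>
  The expectation over one call to a bag in state \<open>\<beta>\<close>, where \<open>F\<close> receives the bit returned and the new
  state. The geometric variable is \<open>r\<close>, so the position looked up is \<open>Suc r\<close>.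
\<close>

definition bag_mix ::
  "(nat \<Rightarrow> bool option) \<Rightarrow> (bool \<Rightarrow> (nat \<Rightarrow> bool option) \<Rightarrow> ennreal) \<Rightarrow> ennreal" where
  "bag_mix \<beta> F = (\<Sum>r. ennreal ((1/2) ^ Suc r) *
     (case \<beta> (Suc r) of
        Some u \<Rightarrow> F u \<beta>
      | None \<Rightarrow> mix (1/2) (\<lambda>u. F u (\<beta>(Suc r \<mapsto> u)))))"

text \<open>
  The expected number of flips in one call to a bag in state \<open>\<beta>\<close>: \<open>Suc r\<close> of them draw the geometric
  variable, and one more is needed for a bit that is still unassigned.
\<close>

definition bag_cost :: "(nat \<Rightarrow> bool option) \<Rightarrow> ennreal" where
  "bag_cost \<beta> = (\<Sum>r. ennreal ((1/2) ^ Suc r) * of_nat (Suc r + of_bool (\<beta> (Suc r) = None)))"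

text \<open>
  The counterpart of \<open>payoff\<close> for the machine with a bag. The price \<open>\<kappa>\<close> of a call to the source is a
  parameter: with \<open>bag_cost\<close> it counts flips exactly, while with a constant price the payoff can
  be compared with that of the machine without a bag.
\<close>

primrec bag_payoff ::
  "program \<Rightarrow> (mem \<Rightarrow> ennreal) \<Rightarrow> ennreal \<Rightarrow> ((nat \<Rightarrow> bool option) \<Rightarrow> ennreal) \<Rightarrow> real
    \<Rightarrow> nat \<Rightarrow> (nat \<Rightarrow> bool option) \<Rightarrow> mem \<Rightarrow> ennreal" where
  "bag_payoff P \<tau> a \<kappa> p 0 \<beta> m = \<tau> m"
| "bag_payoff P \<tau> a \<kappa> p (Suc n) \<beta> m =
     (case node_of P m of
        Done \<Rightarrow> \<tau> m
      | Quiet m' \<Rightarrow> bag_payoff P \<tau> a \<kappa> p n \<beta> m'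
      | Coin k \<Rightarrow> a + mix (1/2) (\<lambda>x. bag_payoff P \<tau> a \<kappa> p n \<beta> (k x))
      | Query k \<Rightarrow> \<kappa> \<beta> + bag_mix \<beta> (\<lambda>u \<beta>'. mix p (\<lambda>g. bag_payoff P \<tau> a \<kappa> p n \<beta>' (k (u \<and> g)))))"

lemma mix_add_const: 
  "0 \<le> p \<Longrightarrow> p \<le> 1 \<Longrightarrow> mix p (\<lambda>b. c + f b) = c + mix p f"
  by (simp add: mix_add mix_const)

text \<open>
  The recursion of \<open>payoff\<close> follows the execution from its first step onwards, and after each call the
  rest of the streams is a fresh sample. The induction therefore has to be about arbitrary starting
  states and arbitrary values of the counters.
\<close>

lemma gamma_payoff:
  fixes P :: program and \<tau> :: "mem \<Rightarrow> ennreal" and a b :: ennreal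
  assumes p: "0 \<le> p" "p \<le> 1"
  defines "X \<equiv> (\<lambda>n m f r \<beta> \<omega>. score a b \<tau> ((step gamma_call P ^^ n) (cfg m (world \<omega> f r \<beta>))))"
  shows "X n m f r \<beta> \<in> borel_measurable (samples p)
    \<and> (\<integral>\<^sup>+ \<omega>. X n m f r \<beta> \<omega> \<partial>samples p) = a * of_nat f + b * of_nat r + payoff P \<tau> a b p n m"
proof (induction n arbitrary: m f r \<beta>)
  interpret S: prob_space "samples p" by (rule prob_space_samples)
  case 0
  show ?case by (simp add: X_def score_cfg_world S.emeasure_space_1[unfolded space_samples])
next
  interpret S: prob_space "samples p" by (rule prob_space_samples)
  case (Suc n)
  show ?case
  proof (cases "node_of P m")
    case Done
    then have "X (Suc n) m f r \<beta> = X n m f r \<beta>"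
      by (simp add: X_def funpow_Suc_right step_cfg del: funpow.simps)
    moreover have "X n m f r \<beta> = (\<lambda>_. a * of_nat f + b * of_nat r + \<tau> m)"
    proof -
      have "(step gamma_call P ^^ n) (cfg m e) = cfg m e" for e
        by (induction n) (simp_all add: step_cfg Done)
      then show ?thesis by (simp add: X_def score_cfg_world)
    qed
    ultimately show ?thesis
      using Done by (simp add: S.emeasure_space_1[unfolded space_samples])
  next
    case (Quiet m')
    then have "X (Suc n) m f r \<beta> = X n m' f r \<beta>"
      by (simp add: X_def funpow_Suc_right step_cfg del: funpow.simps)
    then show ?thesis using Suc Quiet by simp
  next
    case (Coin k)
    then have eq: "X (Suc n) m f r \<beta> =
        (\<lambda>\<omega>. X n (k (shd (fst \<omega>))) (Suc f) r \<beta> (stl (fst \<omega>), snd \<omega>))"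
      by (simp add: X_def funpow_Suc_right step_cfg flip_world del: funpow.simps)
    have m: "X n (k x) (Suc f) r \<beta> \<in> borel_measurable (samples p)" for x
      using Suc by blast
    show ?thesis
      using measurable_draw_fair[of "\<lambda>x. X n (k x) (Suc f) r \<beta>" p, OF m]
        nn_integral_draw_fair[of "\<lambda>x. X n (k x) (Suc f) r \<beta>" p, OF m] Suc Coin
      by (simp add: eq mix_add_const algebra_simps)
  next
    case (Query k)
    then have eq: "X (Suc n) m f r \<beta> =
        (\<lambda>\<omega>. X n (k (shd (snd \<omega>))) f (Suc r) \<beta> (fst \<omega>, stl (snd \<omega>)))"
      by (simp add: X_def funpow_Suc_right step_cfg gamma_call_world del: funpow.simps)
    have m: "X n (k x) f (Suc r) \<beta> \<in> borel_measurable (samples p)" for x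
      using Suc by blast
    show ?thesis
      using measurable_draw_gamma[of "\<lambda>x. X n (k x) f (Suc r) \<beta>" p, OF m]
        nn_integral_draw_gamma[of "\<lambda>x. X n (k x) f (Suc r) \<beta>" p, OF m p] Suc Query p
      by (simp add: eq mix_add_const algebra_simps)
  qed
qed

text \<open>
  The stages of a call are the geometric variable, possibly one flip for the bit, and one read; each of
  them hands a fresh sample on to the next.
\<close>

lemma nn_integral_bag_gamma_call:
  fixes H :: "bool \<Rightarrow> env \<Rightarrow> ennreal" and r :: nat
  assumes p: "0 \<le> p" "p \<le> 1"
    and m: "\<And>x f r \<beta>. (\<lambda>\<omega>. H x (world \<omega> f r \<beta>)) \<in> borel_measurable (samples p)"
  defines "I \<equiv> \<lambda>x f \<beta>. (\<integral>\<^sup>+ \<omega>. H x (world \<omega> f (Suc r) \<beta>) \<partial>samples p)"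
  shows "(\<lambda>\<omega>. case_prod H (bag_gamma_call (world \<omega> f r \<beta>))) \<in> borel_measurable (samples p)"
    and "(\<integral>\<^sup>+ \<omega>. case_prod H (bag_gamma_call (world \<omega> f r \<beta>)) \<partial>samples p) =
      (\<Sum>R. ennreal ((1/2) ^ Suc R) *
         (case \<beta> (Suc R) of
            Some u \<Rightarrow> mix p (\<lambda>g. I (u \<and> g) (f + Suc R) \<beta>)
          | None \<Rightarrow> mix (1/2) (\<lambda>u. mix p (\<lambda>g. I (u \<and> g) (Suc (f + Suc R)) (\<beta>(Suc R \<mapsto> u))))))"
proof -
  define G where "G u f \<beta> \<omega> = H (u \<and> shd (snd \<omega>)) (world (fst \<omega>, stl (snd \<omega>)) f (Suc r) \<beta>)"
    for u f \<beta> and \<omega> :: "bool stream \<times> bool stream"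
  have G: "G u f \<beta> \<in> borel_measurable (samples p)"
    "(\<integral>\<^sup>+ \<omega>. G u f \<beta> \<omega> \<partial>samples p) = mix p (\<lambda>g. I (u \<and> g) f \<beta>)" for u f \<beta>
    using measurable_draw_gamma[of "\<lambda>g \<omega>. H (u \<and> g) (world \<omega> f (Suc r) \<beta>)" p, OF m]
      nn_integral_draw_gamma[of "\<lambda>g \<omega>. H (u \<and> g) (world \<omega> f (Suc r) \<beta>)" p, OF m p]
    by (simp_all add: G_def[abs_def] I_def)
  define F where "F R \<omega> = (case \<beta> (Suc R) of
       Some u \<Rightarrow> G u (f + Suc R) \<beta> \<omega>
     | None \<Rightarrow> G (shd (fst \<omega>)) (Suc (f + Suc R)) (\<beta>(Suc R \<mapsto> shd (fst \<omega>))) (stl (fst \<omega>), snd \<omega>))"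
    for R and \<omega> :: "bool stream \<times> bool stream"
  have F: "F R \<in> borel_measurable (samples p)"
    "(\<integral>\<^sup>+ \<omega>. F R \<omega> \<partial>samples p) = (case \<beta> (Suc R) of
       Some u \<Rightarrow> mix p (\<lambda>g. I (u \<and> g) (f + Suc R) \<beta>)
     | None \<Rightarrow> mix (1/2) (\<lambda>u. mix p (\<lambda>g. I (u \<and> g) (Suc (f + Suc R)) (\<beta>(Suc R \<mapsto> u)))))" for R
    using measurable_draw_fair[of "\<lambda>u. G u (Suc (f + Suc R)) (\<beta>(Suc R \<mapsto> u))" p, OF G(1)]
      nn_integral_draw_fair[of "\<lambda>u. G u (Suc (f + Suc R)) (\<beta>(Suc R \<mapsto> u))" p, OF G(1)] G
    by (cases "\<beta> (Suc R)"; simp add: F_def[abs_def])+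
  have eq: "case_prod H (bag_gamma_call (world \<omega> f r \<beta>)) =
      F (LEAST i. fst \<omega> !! i) (sdrop (Suc (LEAST i. fst \<omega> !! i)) (fst \<omega>), snd \<omega>)" for \<omega>
    by (simp add: bag_gamma_call_world F_def G_def Let_def split: option.split)
  show "(\<lambda>\<omega>. case_prod H (bag_gamma_call (world \<omega> f r \<beta>))) \<in> borel_measurable (samples p)"
    unfolding eq by (rule measurable_draw_geometric[of F p, OF F(1)])
  show "(\<integral>\<^sup>+ \<omega>. case_prod H (bag_gamma_call (world \<omega> f r \<beta>)) \<partial>samples p) =
      (\<Sum>R. ennreal ((1/2) ^ Suc R) *
         (case \<beta> (Suc R) of
            Some u \<Rightarrow> mix p (\<lambda>g. I (u \<and> g) (f + Suc R) \<beta>)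
          | None \<Rightarrow> mix (1/2) (\<lambda>u. mix p (\<lambda>g. I (u \<and> g) (Suc (f + Suc R)) (\<beta>(Suc R \<mapsto> u))))))"
    unfolding eq nn_integral_draw_geometric[of F p, OF F(1)] F(2) ..
qed

text \<open>
  The proof is that of \<open>gamma_payoff\<close>, except that the number of flips in a call is now random; its
  expectation splits off as \<open>bag_cost\<close>.
\<close>

lemma bag_gamma_payoff:
  fixes P :: program and \<tau> :: "mem \<Rightarrow> ennreal" and a :: ennreal
  assumes p: "0 \<le> p" "p \<le> 1"
  defines "X \<equiv> (\<lambda>n m f r \<beta> \<omega>. score a 0 \<tau> ((step bag_gamma_call P ^^ n) (cfg m (world \<omega> f r \<beta>))))"
  shows "X n m f r \<beta> \<in> borel_measurable (samples p)
    \<and> (\<integral>\<^sup>+ \<omega>. X n m f r \<beta> \<omega> \<partial>samples p)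
      = a * of_nat f + bag_payoff P \<tau> a (\<lambda>\<beta>. a * bag_cost \<beta>) p n \<beta> m"
proof (induction n arbitrary: m f r \<beta>)
  interpret S: prob_space "samples p" by (rule prob_space_samples)
  case 0
  show ?case by (simp add: X_def score_cfg_world S.emeasure_space_1[unfolded space_samples])
next
  interpret S: prob_space "samples p" by (rule prob_space_samples)
  case (Suc n)
  show ?case
  proof (cases "node_of P m")
    case Done
    then have "X (Suc n) m f r \<beta> = X n m f r \<beta>"
      by (simp add: X_def funpow_Suc_right step_cfg del: funpow.simps)
    moreover have "X n m f r \<beta> = (\<lambda>_. a * of_nat f + \<tau> m)"
    proof -
      have "(step bag_gamma_call P ^^ n) (cfg m e) = cfg m e" for e
        by (induction n) (simp_all add: step_cfg Done)
      then show ?thesis by (simp add: X_def score_cfg_world)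
    qed
    ultimately show ?thesis
      using Done by (simp add: S.emeasure_space_1[unfolded space_samples])
  next
    case (Quiet m')
    then have "X (Suc n) m f r \<beta> = X n m' f r \<beta>"
      by (simp add: X_def funpow_Suc_right step_cfg del: funpow.simps)
    then show ?thesis using Suc Quiet by simp
  next
    case (Coin k)
    then have eq: "X (Suc n) m f r \<beta> =
        (\<lambda>\<omega>. X n (k (shd (fst \<omega>))) (Suc f) r \<beta> (stl (fst \<omega>), snd \<omega>))"
      by (simp add: X_def funpow_Suc_right step_cfg flip_world del: funpow.simps)
    have m: "X n (k x) (Suc f) r \<beta> \<in> borel_measurable (samples p)" for x
      using Suc by blast
    show ?thesis
      using measurable_draw_fair[of "\<lambda>x. X n (k x) (Suc f) r \<beta>" p, OF m]
        nn_integral_draw_fair[of "\<lambda>x. X n (k x) (Suc f) r \<beta>" p, OF m] Suc Coin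
      by (simp add: eq mix_add_const algebra_simps)
  next
    case (Query k)
    define H where "H x e = score a 0 \<tau> ((step bag_gamma_call P ^^ n) (cfg (k x) e))" for x e
    have HX: "(\<lambda>\<omega>. H x (world \<omega> f r \<beta>)) = X n (k x) f r \<beta>" for x f r \<beta>
      by (simp add: H_def X_def)
    have m: "(\<lambda>\<omega>. H x (world \<omega> f r \<beta>)) \<in> borel_measurable (samples p)" for x f r \<beta>
      unfolding HX using Suc by blast
    define B where "B u \<beta> = mix p (\<lambda>g. bag_payoff P \<tau> a (\<lambda>\<beta>. a * bag_cost \<beta>) p n \<beta> (k (u \<and> g)))"
      for u \<beta>
    have eq: "X (Suc n) m f r \<beta> = (\<lambda>\<omega>. case_prod H (bag_gamma_call (world \<omega> f r \<beta>)))"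
      using Query by (simp add: X_def H_def funpow_Suc_right step_cfg split_beta del: funpow.simps)
    have "(\<integral>\<^sup>+ \<omega>. X (Suc n) m f r \<beta> \<omega> \<partial>samples p) =
      (\<Sum>R. ennreal ((1/2) ^ Suc R) *
         (case \<beta> (Suc R) of
            Some u \<Rightarrow> a * of_nat (f + Suc R) + B u \<beta>
          | None \<Rightarrow> a * of_nat (Suc (f + Suc R)) + mix (1/2) (\<lambda>u. B u (\<beta>(Suc R \<mapsto> u)))))"
      unfolding eq nn_integral_bag_gamma_call(2)[where H = H, OF p m] unfolding HX
      using Suc p
      by (intro suminf_cong arg_cong2[where f = times] refl)
        (simp add: mix_add_const B_def fun_upd_def split: option.split)
    also have "\<dots> = (\<Sum>R. a * of_nat f * ennreal ((1/2) ^ Suc R)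
        + a * (ennreal ((1/2) ^ Suc R) * of_nat (Suc R + of_bool (\<beta> (Suc R) = None)))
        + ennreal ((1/2) ^ Suc R) * (case \<beta> (Suc R) of
            Some u \<Rightarrow> B u \<beta>
          | None \<Rightarrow> mix (1/2) (\<lambda>u. B u (\<beta>(Suc R \<mapsto> u)))))"
      by (intro suminf_cong) (simp add: algebra_simps split: option.split)
    also have "\<dots> = a * of_nat f + a * bag_cost \<beta> + bag_mix \<beta> B"
      by (simp add: suminf_add[symmetric] ennreal_suminf_cmult suminf_half_powers
          bag_cost_def bag_mix_def del: power_Suc)
    finally show ?thesis
      using nn_integral_bag_gamma_call(1)[where H = H, OF p m] Query
      by (simp add: eq B_def[abs_def] add.assoc)
  qed
qed

section \<open>Output probabilities and expected numbers of calls\<close>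

definition start :: mem where
  "start = (0, \<lambda>_. 0, [])"

lemma run_start: "run src P \<omega> n = (step src P ^^ n) (cfg start (world \<omega> 0 0 Map.empty))"
  by (simp add: run_def init_def cfg_def world_def start_def)

definition prints :: "program \<Rightarrow> int list \<Rightarrow> mem \<Rightarrow> ennreal" where
  "prints P xs m = of_bool (length P \<le> fst m \<and> snd (snd m) = xs)"

lemma score_prints: "score 0 0 (prints P xs) c = of_bool (halted P c \<and> outq c = xs)"
  by (simp add: score_def prints_def halted_def)

lemma run_halted:
  assumes "halted P (run src P \<omega> n)" "n \<le> k"
  shows "run src P \<omega> k = run src P \<omega> n"
  using assms(2)
proof (induction k rule: dec_induct)
  case (step k)
  then show ?case using assms(1) by (simp add: run_def step_def)
qed simp

lemma outputs_unique: "outputs src P \<omega> xs \<Longrightarrow> outputs src P \<omega> ys \<Longrightarrow> xs = ys"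
  unfolding outputs_def by (metis nat_le_linear run_halted)

text \<open>
  A halted machine stays halted, so the event that \<open>xs\<close> is the output is the increasing union of the
  events that it is the output after \<open>n\<close> steps.
\<close>

lemma emeasure_outputs:
  fixes v :: "nat \<Rightarrow> ennreal"
  assumes m: "\<And>n. (\<lambda>\<omega>. score 0 0 (prints P xs) (run src P \<omega> n)) \<in> borel_measurable (samples p)"
    and v: "\<And>n. (\<integral>\<^sup>+ \<omega>. score 0 0 (prints P xs) (run src P \<omega> n) \<partial>samples p) = v n"
  shows "{\<omega>. outputs src P \<omega> xs} \<in> sets (samples p)"
    and "emeasure (samples p) {\<omega>. outputs src P \<omega> xs} = (SUP n. v n)"
proof -
  let ?s = "\<lambda>n \<omega>. score 0 0 (prints P xs) (run src P \<omega> n)"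
  have inc: "incseq ?s"
  proof (intro monoI le_funI)
    fix n k :: nat and \<omega> assume "n \<le> k"
    then show "?s n \<omega> \<le> ?s k \<omega>"
      using run_halted[of P src \<omega> n k] by (cases "halted P (run src P \<omega> n)") (simp_all add: score_prints)
  qed
  have eq: "indicator {\<omega>. outputs src P \<omega> xs} \<omega> = (SUP n. ?s n \<omega>)" for \<omega>
  proof (cases "outputs src P \<omega> xs")
    case True
    then obtain n where "?s n \<omega> = 1"
      by (auto simp: outputs_def score_prints)
    moreover have "?s n \<omega> \<le> 1" for n by (simp add: score_prints)
    ultimately have "(SUP n. ?s n \<omega>) = 1"
      by (intro antisym SUP_least) (auto intro: SUP_upper2[of n])
    then show ?thesis using True by simp
  next
    case False
    then have "?s n \<omega> = 0" for n by (auto simp: outputs_def score_prints)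
    then show ?thesis using False by simp
  qed
  have "(indicator {\<omega>. outputs src P \<omega> xs} :: _ \<Rightarrow> ennreal) \<in> borel_measurable (samples p)"
    using m by (simp add: eq[abs_def])
  then show sets: "{\<omega>. outputs src P \<omega> xs} \<in> sets (samples p)"
    by (subst (asm) borel_measurable_indicator_iff) simp
  have "emeasure (samples p) {\<omega>. outputs src P \<omega> xs} = (\<integral>\<^sup>+ \<omega>. (SUP n. ?s n \<omega>) \<partial>samples p)"
    unfolding eq[symmetric] using sets by simp
  also have "\<dots> = (SUP n. v n)"
    unfolding nn_integral_monotone_convergence_SUP[OF inc m] v ..
  finally show "emeasure (samples p) {\<omega>. outputs src P \<omega> xs} = (SUP n. v n)" .
qed

definition print_prob :: "program \<Rightarrow> real \<Rightarrow> int list \<Rightarrow> mem \<Rightarrow> ennreal" where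
  "print_prob P p xs m = (SUP n. payoff P (prints P xs) 0 0 p n m)"

definition bag_print_prob :: "program \<Rightarrow> real \<Rightarrow> int list \<Rightarrow> ennreal" where
  "bag_print_prob P p xs = (SUP n. bag_payoff P (prints P xs) 0 (\<lambda>_. 0) p n Map.empty start)"

lemma gamma_outputs:
  assumes "0 \<le> p" "p \<le> 1"
  shows sets_gamma_outputs: "{\<omega>. outputs gamma_call P \<omega> xs} \<in> sets (samples p)"
    and emeasure_gamma_outputs:
      "emeasure (samples p) {\<omega>. outputs gamma_call P \<omega> xs} = print_prob P p xs start"
  unfolding print_prob_def
  by (rule emeasure_outputs; use gamma_payoff[OF assms, of 0 0] in \<open>simp add: run_start\<close>)+

lemma bag_outputs:
  assumes "0 \<le> p" "p \<le> 1"
  shows sets_bag_outputs: "{\<omega>. outputs bag_gamma_call P \<omega> xs} \<in> sets (samples p)"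
    and emeasure_bag_outputs:
      "emeasure (samples p) {\<omega>. outputs bag_gamma_call P \<omega> xs} = bag_print_prob P p xs"
  unfolding bag_print_prob_def
  by (rule emeasure_outputs; use bag_gamma_payoff[OF assms, of 0] in \<open>simp add: run_start\<close>)+

text \<open>
  The outputs 1 and 0 exclude each other, so a single bit is output almost surely if and only if the
  probabilities of these two outputs add up to 1.
\<close>

lemma weakly_realizes_iff:
  assumes sets: "\<And>l xs. l \<in> {0<..<1} \<Longrightarrow> {\<omega>. outputs src P \<omega> xs} \<in> sets (samples l)"
  shows "weakly_realizes src P \<phi> \<longleftrightarrow> (\<forall>l\<in>{0<..<1}. \<phi> l \<in> {0<..<1} \<and>
      emeasure (samples l) {\<omega>. outputs src P \<omega> [1]} = ennreal (\<phi> l) \<and>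
      emeasure (samples l) {\<omega>. outputs src P \<omega> [0]} = ennreal (1 - \<phi> l))"
  unfolding weakly_realizes_def
proof (rule ball_cong[OF refl], rule conj_cong[OF refl])
  fix l :: real assume l: "l \<in> {0<..<1}" and \<phi>: "\<phi> l \<in> {0<..<1}"
  interpret S: prob_space "samples l" by (rule prob_space_samples)
  let ?A = "\<lambda>x. {\<omega>. outputs src P \<omega> [x]}"
  have [measurable]: "?A x \<in> sets (samples l)" for x by (rule sets[OF l])
  have "(AE \<omega> in samples l. \<exists>b. outputs src P \<omega> [of_bool b]) \<longleftrightarrow>
      (AE \<omega> in samples l. \<omega> \<in> ?A 1 \<union> ?A 0)"
    by (intro AE_cong) (auto simp: ex_bool_eq)
  also have "\<dots> \<longleftrightarrow> measure (samples l) (?A 1 \<union> ?A 0) = 1"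
    by (rule S.prob_eq_1[symmetric]) measurable
  also have "measure (samples l) (?A 1 \<union> ?A 0) = measure (samples l) (?A 1) + measure (samples l) (?A 0)"
    by (rule S.finite_measure_Union) (auto dest: outputs_unique)
  finally show "(AE \<omega> in samples l. \<exists>b. outputs src P \<omega> [of_bool b]) \<and>
      measure (samples l) {\<omega> \<in> space (samples l). outputs src P \<omega> [1]} = \<phi> l \<longleftrightarrow>
      emeasure (samples l) (?A 1) = ennreal (\<phi> l) \<and> emeasure (samples l) (?A 0) = ennreal (1 - \<phi> l)"
    using \<phi> by (auto simp: S.emeasure_eq_measure)
qed

lemma gamma_weakly_realizes_iff:
  "weakly_realizes gamma_call P \<phi> \<longleftrightarrow> (\<forall>l\<in>{0<..<1}. \<phi> l \<in> {0<..<1} \<and>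
      print_prob P l [1] start = ennreal (\<phi> l) \<and> print_prob P l [0] start = ennreal (1 - \<phi> l))"
  by (subst weakly_realizes_iff) (auto simp: sets_gamma_outputs emeasure_gamma_outputs)

lemma bag_weakly_realizes_iff:
  "weakly_realizes bag_gamma_call P \<phi> \<longleftrightarrow> (\<forall>l\<in>{0<..<1}. \<phi> l \<in> {0<..<1} \<and>
      bag_print_prob P l [1] = ennreal (\<phi> l) \<and> bag_print_prob P l [0] = ennreal (1 - \<phi> l))"
  by (subst weakly_realizes_iff) (auto simp: sets_bag_outputs emeasure_bag_outputs)

lemma incseq_run:
  fixes c :: "env \<Rightarrow> nat"
  assumes "\<And>e. c e \<le> c (snd (flip e))" "\<And>e. c e \<le> c (snd (src e))"
  shows "incseq (\<lambda>n. c (env (run src P \<omega> n)))"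
proof (rule incseq_SucI)
  fix n
  have "c (env x) \<le> c (env (step src P x))" for x
    using assms[of "env x"]
    by (cases "P ! pc x") (auto simp: step_def split_beta)
  then show "c (env (run src P \<omega> n)) \<le> c (env (run src P \<omega> (Suc n)))"
    by (simp add: run_def)
qed

lemma calls_increase:
  "flips e \<le> flips (snd (flip e))" "reads e \<le> reads (snd (flip e))"
  "flips e \<le> flips (snd (gamma_call e))" "reads e \<le> reads (snd (gamma_call e))"
  "flips e \<le> flips (snd (bag_gamma_call e))"
  by (auto simp: flip_def gamma_call_def bag_gamma_call_def bag_call_def geometric_call_def Let_def
      split_beta split: option.split)

lemma nn_integral_SUP_count:
  fixes c :: "env \<Rightarrow> nat"
  assumes inc: "\<And>\<omega>. incseq (\<lambda>n. c (env (run src P \<omega> n)))"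
    and m: "\<And>n. (\<lambda>\<omega>. of_nat (c (env (run src P \<omega> n))) :: ennreal) \<in> borel_measurable (samples p)"
    and v: "\<And>n. (\<integral>\<^sup>+ \<omega>. of_nat (c (env (run src P \<omega> n))) \<partial>samples p) = v n"
  shows "(\<integral>\<^sup>+ \<omega>. (SUP n. ennreal (real (c (env (run src P \<omega> n))))) \<partial>samples p) = (SUP n. v n)"
proof -
  have "incseq (\<lambda>n \<omega>. ennreal (real (c (env (run src P \<omega> n)))))"
    using inc by (auto simp: incseq_def le_fun_def intro!: ennreal_leI)
  then show ?thesis
    using m v by (simp add: nn_integral_monotone_convergence_SUP ennreal_of_nat_eq_real_of_nat)
qed

lemma expected_flips_gamma:
  assumes "0 \<le> p" "p \<le> 1"
  shows "expected_flips gamma_call P p = (SUP n. payoff P (\<lambda>_. 0) 1 0 p n start)"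
  unfolding expected_flips_def
  using gamma_payoff[OF assms, of 1 0 "\<lambda>_. 0"]
  by (intro nn_integral_SUP_count incseq_run calls_increase) (simp_all add: run_start score_def)

lemma expected_reads_gamma:
  assumes "0 \<le> p" "p \<le> 1"
  shows "expected_reads gamma_call P p = (SUP n. payoff P (\<lambda>_. 0) 0 1 p n start)"
  unfolding expected_reads_def
  using gamma_payoff[OF assms, of 0 1 "\<lambda>_. 0"]
  by (intro nn_integral_SUP_count incseq_run calls_increase) (simp_all add: run_start score_def)

lemma expected_flips_bag:
  assumes "0 \<le> p" "p \<le> 1"
  shows "expected_flips bag_gamma_call P p
    = (SUP n. bag_payoff P (\<lambda>_. 0) 1 bag_cost p n Map.empty start)"
  unfolding expected_flips_def
  using bag_gamma_payoff[OF assms, of 1 "\<lambda>_. 0"]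
  by (intro nn_integral_SUP_count incseq_run calls_increase) (simp_all add: run_start score_def)

section \<open>The bag as the binary digits of a uniform number\<close>

text \<open>
  Positions are numbered from 1, as in the bag. Digit 0 is the parity of the integer part, hence
  \<open>False\<close> throughout $[0,1)$.
\<close>

definition bin_digit :: "nat \<Rightarrow> real \<Rightarrow> bool" where
  "bin_digit j x \<longleftrightarrow> odd \<lfloor>2 ^ j * x\<rfloor>"

lemma floor_double: "\<lfloor>2 * y\<rfloor> = 2 * \<lfloor>y\<rfloor> + of_bool (odd \<lfloor>2 * y\<rfloor>)" for y :: real
proof -
  have "\<lfloor>y\<rfloor> = \<lfloor>2 * y\<rfloor> div 2"
    using floor_divide_real_eq_div[of 2 "2 * y"] by simp
  moreover have "n = 2 * (n div 2) + of_bool (odd n)" for n :: int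
    unfolding mod_2_eq_odd[symmetric] by simp
  ultimately show ?thesis by metis
qed

text \<open>
  The $n$-th partial sum is $\lfloor 2^n x\rfloor/2^n$.
\<close>

lemma bin_digit_sums:
  assumes "x \<in> {0..<1}"
  shows "(\<lambda>r. (1/2) ^ Suc r * of_bool (bin_digit (Suc r) x)) sums x"
proof -
  have partial: "(\<Sum>r<n. (1/2) ^ Suc r * of_bool (bin_digit (Suc r) x)) = \<lfloor>2 ^ n * x\<rfloor> / 2 ^ n" for n
  proof (induction n)
    case 0
    have "\<lfloor>x\<rfloor> = 0" using assms by (simp add: floor_eq_iff)
    then show ?case by simp
  next
    case (Suc n)
    have "real_of_int \<lfloor>2 ^ Suc n * x\<rfloor> = 2 * \<lfloor>2 ^ n * x\<rfloor> + of_bool (bin_digit (Suc n) x)"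
      using floor_double[of "2 ^ n * x"] by (simp add: bin_digit_def mult.assoc of_bool_def)
    then show ?case using Suc by (simp add: field_simps)
  qed
  have "(\<lambda>n. \<lfloor>2 ^ n * x\<rfloor> / 2 ^ n) \<longlonglongrightarrow> x"
  proof (rule tendsto_sandwich)
    show "\<forall>\<^sub>F n in sequentially. x - (1/2) ^ n \<le> \<lfloor>2 ^ n * x\<rfloor> / 2 ^ n"
    proof (intro always_eventually allI)
      fix n
      have "2 ^ n * x - 1 \<le> \<lfloor>2 ^ n * x\<rfloor>" by linarith
      then have "(2 ^ n * x - 1) / 2 ^ n \<le> \<lfloor>2 ^ n * x\<rfloor> / 2 ^ n"
        by (rule divide_right_mono) simp
      then show "x - (1/2) ^ n \<le> \<lfloor>2 ^ n * x\<rfloor> / 2 ^ n"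
        by (simp add: diff_divide_distrib power_one_over)
    qed
    show "\<forall>\<^sub>F n in sequentially. \<lfloor>2 ^ n * x\<rfloor> / 2 ^ n \<le> x"
    proof (intro always_eventually allI)
      fix n
      have "\<lfloor>2 ^ n * x\<rfloor> \<le> 2 ^ n * x" by linarith
      then show "\<lfloor>2 ^ n * x\<rfloor> / 2 ^ n \<le> x" by (simp add: field_simps)
    qed
    have "(\<lambda>n. x - (1/2) ^ n) \<longlonglongrightarrow> x - 0"
      by (intro tendsto_diff tendsto_const LIMSEQ_power_zero) simp
    then show "(\<lambda>n. x - (1/2) ^ n) \<longlonglongrightarrow> x" by simp
  qed simp
  then show ?thesis unfolding sums_def partial .
qed

text \<open>
  A digit of \<open>x\<close> read at a random position \<open>j\<close>, taken with probability $2^{-j}$, is a Bernoulli variable of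
  parameter \<open>x\<close>: this is the binary expansion of \<open>x\<close>.
\<close>

lemma geometric_digit_mix:
  assumes x: "x \<in> {0..<1}"
  shows "(\<Sum>r. ennreal ((1/2) ^ Suc r) * T (bin_digit (Suc r) x)) = mix x T"
proof -
  let ?d = "\<lambda>r. of_bool (bin_digit (Suc r) x) :: real"
  have 1: "(\<Sum>r. ennreal ((1/2) ^ Suc r * ?d r)) = ennreal x"
    by (rule suminf_ennreal_eq[OF _ bin_digit_sums[OF x]]) simp
  have "(\<lambda>r. (1/2) ^ Suc r - (1/2) ^ Suc r * ?d r) sums (1 - x)"
    by (intro sums_diff power_half_series bin_digit_sums x)
  then have 2: "(\<Sum>r. ennreal ((1/2) ^ Suc r - (1/2) ^ Suc r * ?d r)) = ennreal (1 - x)"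
    by (intro suminf_ennreal_eq) (auto simp: of_bool_def)
  have "ennreal ((1/2) ^ Suc r) * T (bin_digit (Suc r) x)
      = T True * ennreal ((1/2) ^ Suc r * ?d r) + T False * ennreal ((1/2) ^ Suc r - (1/2) ^ Suc r * ?d r)" for r
    by (cases "bin_digit (Suc r) x") (simp_all add: mult.commute)
  then have "(\<Sum>r. ennreal ((1/2) ^ Suc r) * T (bin_digit (Suc r) x))
      = T True * (\<Sum>r. ennreal ((1/2) ^ Suc r * ?d r))
        + T False * (\<Sum>r. ennreal ((1/2) ^ Suc r - (1/2) ^ Suc r * ?d r))"
    by (simp only: suminf_add[symmetric, OF summableI summableI] ennreal_suminf_cmult)
  then show ?thesis unfolding 1 2 by (simp add: mix_def mult.commute)
qed

text \<open>
  The conjunction of independent Bernoulli variables is one whose parameter is the product.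
\<close>

lemma mix_mix:
  assumes "0 \<le> l" "l \<le> 1" "0 \<le> x" "x \<le> 1"
  shows "mix x (\<lambda>u. mix l (\<lambda>g. f (u \<and> g))) = mix (l * x) f"
proof -
  have "mix x (\<lambda>u. mix l (\<lambda>g. f (u \<and> g)))
      = ennreal (x * l) * f True + (ennreal (x * (1 - l)) + ennreal (1 - x)) * f False"
    using assms mix_const[of l "f False"]
    by (simp add: mix_def[of x] mix_def[of l f] distrib_left distrib_right ennreal_mult mult.assoc add.assoc)
  also have "ennreal (x * (1 - l)) + ennreal (1 - x) = ennreal (1 - l * x)"
    using assms by (subst ennreal_plus[symmetric]) (auto simp: algebra_simps intro!: mult_left_le_one_le)
  finally show ?thesis by (simp add: mix_def mult.commute)
qed

text \<open>
  The interval is half-open so that each binary digit cuts it into intervals of the same kind.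
\<close>

definition unit_interval :: "real measure" where
  "unit_interval = restrict_space lborel {0..<1}"

lemma space_unit_interval[simp]: "space unit_interval = {0..<1}"
  by (simp add: unit_interval_def space_restrict_space)

lemma measurable_unit_interval: "f \<in> borel_measurable borel \<Longrightarrow> f \<in> borel_measurable unit_interval"
  unfolding unit_interval_def by (rule measurable_restrict_space1) simp

lemma nn_integral_unit_interval:
  "(\<integral>\<^sup>+ x. f x \<partial>unit_interval) = (\<integral>\<^sup>+ x. f x * indicator {0..<1} x \<partial>lborel)"
  unfolding unit_interval_def by (rule nn_integral_restrict_space) simp

lemma nn_integral_unit_interval_halve:
  assumes [measurable]: "f \<in> borel_measurable borel"
  shows "(\<integral>\<^sup>+ x. f x \<partial>unit_interval)
    = mix (1/2) (\<lambda>u. \<integral>\<^sup>+ x. f ((of_bool u + x) / 2) \<partial>unit_interval)"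
proof -
  have half: "(\<integral>\<^sup>+ x. f x * indicator {of_bool u/2..<(1 + of_bool u)/2} x \<partial>lborel)
      = ennreal (1/2) * (\<integral>\<^sup>+ x. f ((of_bool u + x) / 2) * indicator {0..<1} x \<partial>lborel)" for u
    by (subst nn_integral_real_affine[where c = "1/2" and t = "of_bool u / 2"])
      (auto intro!: nn_integral_cong arg_cong2[where f = times] arg_cong[where f = f]
        simp: indicator_def field_simps)
  have "(\<integral>\<^sup>+ x. f x \<partial>unit_interval) = (\<integral>\<^sup>+ x. f x * indicator {0..<1/2} x + f x * indicator {1/2..<1} x \<partial>lborel)"
    unfolding nn_integral_unit_interval by (intro nn_integral_cong) (auto simp: indicator_def)
  also have "\<dots> = (\<integral>\<^sup>+ x. f x * indicator {0..<1/2} x \<partial>lborel) + (\<integral>\<^sup>+ x. f x * indicator {1/2..<1} x \<partial>lborel)"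
    by (rule nn_integral_add) measurable
  finally show ?thesis
    using half[of False] half[of True] by (simp add: mix_def nn_integral_unit_interval add.commute)
qed

text \<open>
  Given the bits assigned so far, the number held by the bag is uniformly distributed on this set.
\<close>

definition agree :: "(nat \<Rightarrow> bool option) \<Rightarrow> real set" where
  "agree \<beta> = {x. \<forall>j u. \<beta> j = Some u \<longrightarrow> bin_digit j x = u}"

lemma measurable_bin_digit[measurable]: "Measurable.pred borel (bin_digit j)"
  unfolding bin_digit_def by measurable

lemma agree_sets[measurable]: "agree \<beta> \<in> sets borel"
proof -
  have "{x \<in> space borel. \<forall>j u. \<beta> j = Some u \<longrightarrow> bin_digit j x = u} \<in> sets borel"
    by measurable
  then show ?thesis by (simp add: agree_def)
qed

lemma indicator_agree_upd:
  "\<beta> j = None \<Longrightarrow> indicator (agree (\<beta>(j \<mapsto> u))) x = (indicator (agree \<beta>) x * of_bool (bin_digit j x = u) :: ennreal)"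
  by (auto simp: agree_def indicator_def)

definition weight :: "(nat \<Rightarrow> bool option) \<Rightarrow> ennreal" where
  "weight \<beta> = (\<integral>\<^sup>+ x. indicator (agree \<beta>) x \<partial>unit_interval)"

text \<open>
  The state of a bag for the number that remains when the leading binary digit is removed. Position 0
  is not a position of the bag and stays unassigned.
\<close>

definition bag_tail :: "(nat \<Rightarrow> bool option) \<Rightarrow> nat \<Rightarrow> bool option" where
  "bag_tail \<beta> j = (if j = 0 then None else \<beta> (Suc j))"

lemma bin_digit_half:
  assumes "x \<in> {0..<1}"
  shows "bin_digit (Suc 0) ((of_bool u + x) / 2) = u"
    and "bin_digit (Suc (Suc j)) ((of_bool u + x) / 2) = bin_digit (Suc j) x"
proof -
  have "\<lfloor>of_bool u + x\<rfloor> = of_bool u" using assms by (auto simp: floor_eq_iff)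
  moreover have "2 ^ Suc 0 * ((of_bool u + x) / 2) = of_bool u + x" by simp
  ultimately show "bin_digit (Suc 0) ((of_bool u + x) / 2) = u"
    unfolding bin_digit_def by (simp only:) simp
  have "2 ^ Suc (Suc j) * ((of_bool u + x) / 2) = 2 ^ Suc j * x + of_int (2 ^ Suc j * of_bool u)"
    by (simp add: algebra_simps)
  then have "\<lfloor>2 ^ Suc (Suc j) * ((of_bool u + x) / 2)\<rfloor> = \<lfloor>2 ^ Suc j * x\<rfloor> + 2 ^ Suc j * of_bool u"
    by (simp only: floor_add_int)
  then show "bin_digit (Suc (Suc j)) ((of_bool u + x) / 2) = bin_digit (Suc j) x"
    unfolding bin_digit_def by simp
qed

lemma agree_half:
  assumes "\<beta> 0 = None" "x \<in> {0..<1}"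
  shows "(of_bool u + x) / 2 \<in> agree \<beta> \<longleftrightarrow> \<beta> 1 \<noteq> Some (\<not> u) \<and> x \<in> agree (bag_tail \<beta>)"
proof -
  (* Position 0 is unassigned and position 1 carries the digit u; the rest is shifted. *)
  have all_nat: "(\<forall>j. Q j) \<longleftrightarrow> Q 0 \<and> Q (Suc 0) \<and> (\<forall>j. Q (Suc (Suc j)))" for Q
    by (metis not0_implies_Suc)
  have all_nat': "(\<forall>j. Q j) \<longleftrightarrow> Q 0 \<and> (\<forall>j. Q (Suc j))" for Q
    by (metis not0_implies_Suc)
  have "(of_bool u + x) / 2 \<in> agree \<beta> \<longleftrightarrow> (\<forall>v. \<beta> (Suc 0) = Some v \<longrightarrow> u = v)
      \<and> (\<forall>j v. \<beta> (Suc (Suc j)) = Some v \<longrightarrow> bin_digit (Suc j) x = v)"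
    unfolding agree_def mem_Collect_eq
    by (subst all_nat) (simp add: assms(1) bin_digit_half[OF assms(2)])
  also have "(\<forall>j v. \<beta> (Suc (Suc j)) = Some v \<longrightarrow> bin_digit (Suc j) x = v) \<longleftrightarrow> x \<in> agree (bag_tail \<beta>)"
    unfolding agree_def mem_Collect_eq by (subst (2) all_nat') (simp add: bag_tail_def)
  finally show ?thesis by auto
qed

lemma weight_halve:
  assumes "\<beta> 0 = None"
  shows "weight \<beta> = mix (1/2) (\<lambda>u. of_bool (\<beta> 1 \<noteq> Some (\<not> u)) * weight (bag_tail \<beta>))"
proof -
  have "weight \<beta> = mix (1/2) (\<lambda>u. \<integral>\<^sup>+ x. indicator (agree \<beta>) ((of_bool u + x) / 2) \<partial>unit_interval)"
    unfolding weight_def by (rule nn_integral_unit_interval_halve) measurable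
  also have "(\<lambda>u. \<integral>\<^sup>+ x. indicator (agree \<beta>) ((of_bool u + x) / 2) \<partial>unit_interval)
      = (\<lambda>u. of_bool (\<beta> 1 \<noteq> Some (\<not> u)) * weight (bag_tail \<beta>))"
  proof
    fix u
    have "(\<integral>\<^sup>+ x. indicator (agree \<beta>) ((of_bool u + x) / 2) \<partial>unit_interval)
        = (\<integral>\<^sup>+ x. of_bool (\<beta> 1 \<noteq> Some (\<not> u)) * indicator (agree (bag_tail \<beta>)) x \<partial>unit_interval)"
      by (intro nn_integral_cong) (simp add: indicator_def agree_half[of \<beta>, OF assms])
    also have "\<dots> = of_bool (\<beta> 1 \<noteq> Some (\<not> u)) * weight (bag_tail \<beta>)"
      unfolding weight_def
      by (intro nn_integral_cmult measurable_unit_interval) measurable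
    finally show "(\<integral>\<^sup>+ x. indicator (agree \<beta>) ((of_bool u + x) / 2) \<partial>unit_interval)
      = of_bool (\<beta> 1 \<noteq> Some (\<not> u)) * weight (bag_tail \<beta>)" .
  qed
  finally show ?thesis .
qed

text \<open>
  Given the assigned digits, an unassigned one is still a fair bit. Halving the unit interval removes the
  leading digit and thereby moves the position in question one step to the front, until it is the leading
  one.
\<close>

lemma weight_upd:
  assumes "\<beta> 0 = None" "\<beta> (Suc j) = None"
  shows "weight (\<beta>(Suc j \<mapsto> u)) = ennreal (1/2) * weight \<beta>"
  using assms
proof (induction j arbitrary: \<beta>)
  case 0
  define \<beta>' where "\<beta>' = \<beta>(Suc 0 \<mapsto> u)"
  have "\<beta>' 0 = None" "\<beta>' 1 = Some u" "bag_tail \<beta>' = bag_tail \<beta>"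
    using 0 by (auto simp: \<beta>'_def bag_tail_def)
  then have "weight \<beta>' = ennreal (1/2) * weight \<beta>"
    using 0 weight_halve[of \<beta>] weight_halve[of \<beta>'] by (cases u) (simp_all add: mix_const, simp_all add: mix_def)
  then show ?case unfolding \<beta>'_def .
next
  case (Suc j)
  define \<beta>' where "\<beta>' = \<beta>(Suc (Suc j) \<mapsto> u)"
  have "\<beta>' 0 = None" "\<beta>' 1 = \<beta> 1" "bag_tail \<beta>' = (bag_tail \<beta>)(Suc j \<mapsto> u)"
    using Suc.prems by (auto simp: \<beta>'_def bag_tail_def)
  moreover have "weight ((bag_tail \<beta>)(Suc j \<mapsto> u)) = ennreal (1/2) * weight (bag_tail \<beta>)"
    using Suc.prems by (intro Suc.IH) (simp_all add: bag_tail_def)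
  ultimately have "weight \<beta>' = ennreal (1/2) * weight \<beta>"
    using Suc.prems weight_halve[of \<beta>] weight_halve[of \<beta>'] by (simp add: mix_def ac_simps distrib_left)
  then show ?case unfolding \<beta>'_def .
qed

lemma weight_empty: "weight Map.empty = 1"
  by (simp add: weight_def agree_def unit_interval_def emeasure_restrict_space space_restrict_space)

lemma measurable_payoff[measurable]: "(\<lambda>p. payoff P \<tau> a b p n m) \<in> borel_measurable borel"
proof (induction n arbitrary: m)
  case (Suc n)
  show ?case
    by (cases "node_of P m") (use Suc in simp_all)
qed simp

lemma mix_cmult: "c * mix p f = mix p (\<lambda>b. c * f b)"
  by (simp add: mix_def distrib_left mult.left_commute)

lemma nn_integral_mix:
  assumes "\<And>b. f b \<in> borel_measurable N"
  shows "(\<integral>\<^sup>+ x. mix p (\<lambda>b. f b x) \<partial>N) = mix p (\<lambda>b. \<integral>\<^sup>+ x. f b x \<partial>N)"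
  using assms by (simp add: mix_def nn_integral_add nn_integral_cmult)

text \<open>
  Lazy assignment of the bits amounts to conditioning on them: the payoff of the machine with a bag in
  state \<open>\<beta>\<close> is the mean over \<open>agree \<beta>\<close> of the payoffs of the machine without a bag at the parameters \<open>l * x\<close>.
  Multiplying by the weight of \<open>agree \<beta>\<close>, instead of dividing the integral by it, keeps the weights of
  the two halves additive and spares a proof that they are positive.
\<close>

lemma bag_payoff_weight:
  assumes l: "0 \<le> l" "l \<le> 1" and "\<beta> 0 = None"
  shows "weight \<beta> * bag_payoff P \<tau> a (\<lambda>_. b) l n \<beta> m
    = (\<integral>\<^sup>+ x. indicator (agree \<beta>) x * payoff P \<tau> a b (l * x) n m \<partial>unit_interval)"
  using assms(3)
proof (induction n arbitrary: m \<beta>)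
  have [measurable]: "indicator (agree \<beta>) \<in> borel_measurable unit_interval" for \<beta>
    by (rule measurable_unit_interval) measurable
  have const: "weight \<beta> * c = (\<integral>\<^sup>+ x. indicator (agree \<beta>) x * c \<partial>unit_interval)" for \<beta> c
    unfolding weight_def by (rule nn_integral_multc[symmetric]) measurable
  {
    case 0
    show ?case by (simp add: const)
  next
    case (Suc n)
    let ?p = "\<lambda>m x. payoff P \<tau> a b (l * x) n m"
    have [measurable]: "?p m \<in> borel_measurable unit_interval" for m
      by (rule measurable_unit_interval) measurable
    show ?case
    proof (cases "node_of P m")
      case Done
      then show ?thesis by (simp add: const)
    next
      case (Quiet m')
      then show ?thesis using Suc by simp
    next
      case (Coin k)
      have "(\<integral>\<^sup>+ x. indicator (agree \<beta>) x * (a + mix (1/2) (\<lambda>u. ?p (k u) x)) \<partial>unit_interval)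
          = (\<integral>\<^sup>+ x. indicator (agree \<beta>) x * a + mix (1/2) (\<lambda>u. indicator (agree \<beta>) x * ?p (k u) x) \<partial>unit_interval)"
        by (simp add: distrib_left mix_cmult)
      also have "\<dots> = weight \<beta> * a + mix (1/2) (\<lambda>u. \<integral>\<^sup>+ x. indicator (agree \<beta>) x * ?p (k u) x \<partial>unit_interval)"
        by (simp add: nn_integral_add nn_integral_mix const)
      finally show ?thesis
        using Coin Suc by (simp add: distrib_left mix_cmult)
    next
      case (Query k)
      define T where "T u x = mix l (\<lambda>g. ?p (k (u \<and> g)) x)" for u x
      define B where "B u \<beta> = mix l (\<lambda>g. bag_payoff P \<tau> a (\<lambda>_. b) l n \<beta> (k (u \<and> g)))" for u \<beta>
      have [measurable]: "T u \<in> borel_measurable unit_interval" for u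
        unfolding T_def by measurable
      have [measurable]: "Measurable.pred unit_interval (bin_digit j)" for j
        unfolding unit_interval_def by (rule measurable_restrict_space1) measurable
      have B: "weight \<beta> * B u \<beta> = (\<integral>\<^sup>+ x. indicator (agree \<beta>) x * T u x \<partial>unit_interval)"
        if "\<beta> 0 = None" for u \<beta>
        using Suc.IH[of \<beta>, OF that] by (simp add: B_def T_def mix_cmult nn_integral_mix)
      (* An assigned digit is constant on agree \<beta>. An unassigned one cuts this set into the
         sets for the two extended states, each with half of the weight. *)
      have call: "weight \<beta> * (case \<beta> (Suc r) of Some u \<Rightarrow> B u \<beta> | None \<Rightarrow> mix (1/2) (\<lambda>u. B u (\<beta>(Suc r \<mapsto> u))))
          = (\<integral>\<^sup>+ x. indicator (agree \<beta>) x * T (bin_digit (Suc r) x) x \<partial>unit_interval)" for r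
      proof (cases "\<beta> (Suc r)")
        case (Some u)
        have "(\<integral>\<^sup>+ x. indicator (agree \<beta>) x * T u x \<partial>unit_interval)
            = (\<integral>\<^sup>+ x. indicator (agree \<beta>) x * T (bin_digit (Suc r) x) x \<partial>unit_interval)"
          using Some by (intro nn_integral_cong) (auto simp: agree_def indicator_def)
        then show ?thesis using Some B[of \<beta>, OF Suc.prems] by simp
      next
        case None
        have "weight \<beta> * mix (1/2) (\<lambda>u. B u (\<beta>(Suc r \<mapsto> u)))
            = weight (\<beta>(Suc r \<mapsto> True)) * B True (\<beta>(Suc r \<mapsto> True))
              + weight (\<beta>(Suc r \<mapsto> False)) * B False (\<beta>(Suc r \<mapsto> False))"
          unfolding weight_upd[of \<beta>, OF Suc.prems None]
          by (simp add: mix_def distrib_left mult.left_commute mult.commute mult.assoc)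
        also have "\<dots> = (\<integral>\<^sup>+ x. indicator (agree (\<beta>(Suc r \<mapsto> True))) x * T True x
            + indicator (agree (\<beta>(Suc r \<mapsto> False))) x * T False x \<partial>unit_interval)"
          using Suc.prems by (simp add: B nn_integral_add)
        also have "\<dots> = (\<integral>\<^sup>+ x. indicator (agree \<beta>) x * T (bin_digit (Suc r) x) x \<partial>unit_interval)"
          by (intro nn_integral_cong) (simp add: indicator_agree_upd[of \<beta>, OF None])
        finally show ?thesis using None by simp
      qed
      have [measurable]: "(\<lambda>x. T (bin_digit j x) x) \<in> borel_measurable unit_interval" for j
        by (rule measurable_choice) measurable
      have "weight \<beta> * bag_mix \<beta> B = (\<Sum>r. ennreal ((1/2) ^ Suc r)
          * (weight \<beta> * (case \<beta> (Suc r) of Some u \<Rightarrow> B u \<beta> | None \<Rightarrow> mix (1/2) (\<lambda>u. B u (\<beta>(Suc r \<mapsto> u))))))"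
        unfolding bag_mix_def ennreal_suminf_cmult[symmetric] by (intro suminf_cong) (rule mult.left_commute)
      also have "\<dots> = (\<Sum>r. \<integral>\<^sup>+ x. ennreal ((1/2) ^ Suc r)
          * (indicator (agree \<beta>) x * T (bin_digit (Suc r) x) x) \<partial>unit_interval)"
        unfolding call by (intro suminf_cong nn_integral_cmult[symmetric]) measurable
      also have "\<dots> = (\<integral>\<^sup>+ x. (\<Sum>r. ennreal ((1/2) ^ Suc r)
          * (indicator (agree \<beta>) x * T (bin_digit (Suc r) x) x)) \<partial>unit_interval)"
        by (intro nn_integral_suminf[symmetric]) measurable
      also have "\<dots> = (\<integral>\<^sup>+ x. indicator (agree \<beta>) x * mix (l * x) (\<lambda>u. ?p (k u) x) \<partial>unit_interval)"
      proof (intro nn_integral_cong)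
        fix x assume "x \<in> space unit_interval"
        then have x: "x \<in> {0..<1}" by simp
        have "(\<Sum>r. ennreal ((1/2) ^ Suc r) * (indicator (agree \<beta>) x * T (bin_digit (Suc r) x) x))
            = indicator (agree \<beta>) x * (\<Sum>r. ennreal ((1/2) ^ Suc r) * T (bin_digit (Suc r) x) x)"
          unfolding ennreal_suminf_cmult[symmetric] by (intro suminf_cong) (rule mult.left_commute)
        also have "(\<Sum>r. ennreal ((1/2) ^ Suc r) * T (bin_digit (Suc r) x) x) = mix x (\<lambda>u. T u x)"
          by (rule geometric_digit_mix[OF x])
        also have "mix x (\<lambda>u. T u x) = mix (l * x) (\<lambda>u. ?p (k u) x)"
          unfolding T_def using x l by (intro mix_mix) auto
        finally show "(\<Sum>r. ennreal ((1/2) ^ Suc r) * (indicator (agree \<beta>) x * T (bin_digit (Suc r) x) x))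
            = indicator (agree \<beta>) x * mix (l * x) (\<lambda>u. ?p (k u) x)" .
      qed
      finally have bm: "weight \<beta> * bag_mix \<beta> B
          = (\<integral>\<^sup>+ x. indicator (agree \<beta>) x * mix (l * x) (\<lambda>u. ?p (k u) x) \<partial>unit_interval)" .
      have [measurable]: "(\<lambda>x. mix (l * x) (\<lambda>u. ?p (k u) x)) \<in> borel_measurable unit_interval"
        by (rule measurable_unit_interval) measurable
      have "(\<integral>\<^sup>+ x. indicator (agree \<beta>) x * (b + mix (l * x) (\<lambda>u. ?p (k u) x)) \<partial>unit_interval)
          = weight \<beta> * b + weight \<beta> * bag_mix \<beta> B"
        unfolding bm by (simp add: distrib_left nn_integral_add const)
      then show ?thesis
        using Query by (simp add: distrib_left B_def[abs_def])
    qed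
  }
qed

lemma bag_payoff_eq_integral:
  assumes "0 \<le> l" "l \<le> 1"
  shows "bag_payoff P \<tau> a (\<lambda>_. b) l n Map.empty m = (\<integral>\<^sup>+ x. payoff P \<tau> a b (l * x) n m \<partial>unit_interval)"
  using bag_payoff_weight[OF assms, of Map.empty P \<tau> a b n m] by (simp add: weight_empty agree_def)

text \<open>
  The geometric variable accounts for two flips on average, the bit itself for at most one. The partial
  sums for a bag without any assigned bit are explicit.
\<close>

lemma bag_cost_le: "bag_cost \<beta> \<le> 3"
proof -
  have real: "(\<Sum>r<n. (1/2) ^ Suc r * (real r + 2)) = 3 - (real n + 3) / 2 ^ n" for n
    by (induction n) (simp_all add: field_simps)
  have "(\<Sum>r<n. ennreal ((1/2) ^ Suc r) * of_nat (Suc r + of_bool (\<beta> (Suc r) = None))) \<le> 3" for n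
  proof -
    have "(\<Sum>r<n. ennreal ((1/2) ^ Suc r) * of_nat (Suc r + of_bool (\<beta> (Suc r) = None)))
        \<le> (\<Sum>r<n. ennreal ((1/2) ^ Suc r * (real r + 2)))"
    proof (intro sum_mono)
      fix r
      have "real (Suc r + of_bool (\<beta> (Suc r) = None)) \<le> real r + 2" by simp
      then show "ennreal ((1/2) ^ Suc r) * of_nat (Suc r + of_bool (\<beta> (Suc r) = None))
          \<le> ennreal ((1/2) ^ Suc r * (real r + 2))"
        unfolding ennreal_of_nat_eq_real_of_nat
        by (subst ennreal_mult[symmetric]) (auto intro!: ennreal_leI mult_left_mono simp del: power_Suc)
    qed
    also have "\<dots> = ennreal (3 - (real n + 3) / 2 ^ n)"
      by (subst sum_ennreal) (simp_all add: real del: power_Suc)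
    also have "\<dots> \<le> ennreal 3" by (intro ennreal_leI) simp
    finally show ?thesis by simp
  qed
  then show ?thesis unfolding bag_cost_def suminf_eq_SUP by (intro SUP_least)
qed

lemma bag_payoff_mono_cost:
  assumes "\<And>\<beta>. \<kappa> \<beta> \<le> \<kappa>' \<beta>"
  shows "bag_payoff P \<tau> a \<kappa> p n \<beta> m \<le> bag_payoff P \<tau> a \<kappa>' p n \<beta> m"
proof (induction n arbitrary: \<beta> m)
  case (Suc n)
  have bm: "bag_mix \<beta> F \<le> bag_mix \<beta> F'" if "\<And>u \<beta>. F u \<beta> \<le> F' u \<beta>" for F F' \<beta>
    unfolding bag_mix_def
    by (intro suminf_le summableI mult_left_mono) (auto simp: that mix_mono split: option.split)
  then show ?case
    by (cases "node_of P m") (simp_all add: Suc assms bm add_mono mix_mono)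
qed simp

lemma payoff_linear: "payoff P (\<lambda>_. 0) 1 3 p n m
    = payoff P (\<lambda>_. 0) 1 0 p n m + 3 * payoff P (\<lambda>_. 0) 0 1 p n m"
proof (induction n arbitrary: m)
  case (Suc n)
  then show ?case
    by (cases "node_of P m") (simp_all add: mix_add mix_cmult[symmetric] distrib_left add_ac)
qed simp

text \<open>
  Output is final: once a machine has halted, further steps change nothing.
\<close>

lemma payoff_prints_mono: "payoff P (prints P xs) 0 0 p n m \<le> payoff P (prints P xs) 0 0 p (Suc n) m"
proof (induction n arbitrary: m)
  case 0
  show ?case
    by (cases m; cases "node_of P m") (auto simp: prints_def split: if_splits)
next
  case (Suc n)
  show ?case
    by (subst (1 2) payoff.simps(2), cases "node_of P m")
      (simp_all add: Suc mix_mono del: payoff.simps(2))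
qed

lemma incseq_payoff_prints: "incseq (\<lambda>n. payoff P (prints P xs) 0 0 p n m)"
  by (rule incseq_SucI) (rule payoff_prints_mono)

lemma measurable_print_prob[measurable]: "(\<lambda>p. print_prob P p xs m) \<in> borel_measurable borel"
  unfolding print_prob_def by measurable

lemma bag_print_prob_eq_integral:
  assumes "0 \<le> l" "l \<le> 1"
  shows "bag_print_prob P l xs = (\<integral>\<^sup>+ x. print_prob P (l * x) xs start \<partial>unit_interval)"
  unfolding bag_print_prob_def print_prob_def bag_payoff_eq_integral[OF assms]
  using incseq_payoff_prints
  by (intro nn_integral_monotone_convergence_SUP[symmetric] measurable_unit_interval)
    (auto simp: incseq_def le_fun_def)

lemma nn_integral_unit_interval_scale:
  assumes [measurable]: "f \<in> borel_measurable borel" and l: "0 < l"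
  shows "(\<integral>\<^sup>+ x. f (l * x) \<partial>unit_interval) = ennreal (1 / l) * (\<integral>\<^sup>+ w\<in>{0<..<l}. f w \<partial>lborel)"
proof -
  have "(\<integral>\<^sup>+ w\<in>{0<..<l}. f w \<partial>lborel) = (\<integral>\<^sup>+ w. f w * indicator {0..<l} w \<partial>lborel)"
    using AE_lborel_singleton[of 0] by (intro nn_integral_cong_AE) (auto elim!: eventually_mono simp: indicator_def)
  also have "\<dots> = ennreal l * (\<integral>\<^sup>+ x. f (l * x) \<partial>unit_interval)"
    unfolding nn_integral_unit_interval
    by (subst nn_integral_real_affine[where c = l and t = 0])
      (use l in \<open>auto intro!: nn_integral_cong arg_cong2[where f = times] simp: indicator_def zero_le_mult_iff\<close>)
  finally show ?thesis
    using l by (simp add: mult.assoc[symmetric] ennreal_mult[symmetric])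
qed

section \<open>Averaging over the parameter\<close>

text \<open>
  Here \<open>f\<close> stands for an output probability, which is measurable on the whole line, whereas of \<open>\<phi>\<close> it is
  only known that it coincides with \<open>f\<close> on $(0,1)$. Positivity holds because a nonnegative function with integral 0 vanishes almost everywhere.
\<close>

lemma nn_integral_eq_LBINT:
  fixes f :: "real \<Rightarrow> ennreal" and \<phi> :: "real \<Rightarrow> real"
  assumes [measurable]: "f \<in> borel_measurable borel" and l: "l \<in> {0<..<1}"
    and f: "\<And>w. w \<in> {0<..<1} \<Longrightarrow> f w = ennreal (\<phi> w)"
    and \<phi>: "\<And>w. w \<in> {0<..<1} \<Longrightarrow> \<phi> w \<in> {0<..<1}"
  shows "(\<integral>\<^sup>+ w\<in>{0<..<l}. f w \<partial>lborel) = ennreal (LBINT w=0..l. \<phi> w)"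
    and "0 < (LBINT w=0..l. \<phi> w)"
proof -
  let ?g = "\<lambda>w. indicator {0<..<l} w *\<^sub>R enn2real (f w)"
  have int: "integrable lborel ?g"
  proof (rule integrableI_bounded_set_indicator[where B = 1])
    show "AE w in lborel. w \<in> {0<..<l} \<longrightarrow> norm (enn2real (f w)) \<le> 1"
      using l f \<phi> by (auto intro!: AE_I2 simp: less_imp_le)
  qed (use l in auto)
  have LB: "(LBINT w=0..l. \<phi> w) = (\<integral>w. ?g w \<partial>lborel)"
    unfolding interval_lebesgue_integral_def set_lebesgue_integral_def zero_ereal_def einterval_eq
    using l f \<phi> by (auto intro!: Bochner_Integration.integral_cong simp: indicator_def less_imp_le)
  have "(\<integral>\<^sup>+ w\<in>{0<..<l}. f w \<partial>lborel) = (\<integral>\<^sup>+ w. ennreal (?g w) \<partial>lborel)"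
    using l f \<phi> by (intro nn_integral_cong) (auto simp: indicator_def less_imp_le)
  also have "\<dots> = ennreal (\<integral>w. ?g w \<partial>lborel)"
    by (rule nn_integral_eq_integral[OF int]) simp
  finally show eq: "(\<integral>\<^sup>+ w\<in>{0<..<l}. f w \<partial>lborel) = ennreal (LBINT w=0..l. \<phi> w)"
    unfolding LB .
  show "0 < (LBINT w=0..l. \<phi> w)"
  proof (rule ccontr)
    assume "\<not> 0 < (LBINT w=0..l. \<phi> w)"
    then have "(\<integral>\<^sup>+ w\<in>{0<..<l}. f w \<partial>lborel) = 0"
      unfolding eq by (simp add: ennreal_eq_0_iff)
    then have "AE w in lborel. f w * indicator {0<..<l} w = 0"
      by (subst (asm) nn_integral_0_iff_AE) auto
    then have "AE w in lborel. w \<notin> {0<..<l}"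
      by eventually_elim (use l f \<phi> in \<open>force simp: indicator_def\<close>)
    then have "emeasure lborel {0<..<l} = 0"
      by (subst (asm) AE_iff_measurable[OF _ refl]) (auto simp: greaterThanLessThan_def greaterThan_def lessThan_def Int_def)
    then show False using l by simp
  qed
qed

text \<open>
  Averaging \<open>\<phi>\<close> and \<open>1 - \<phi>\<close> over $(0,l)$ gives two positive numbers with sum 1, the probabilities of the
  outputs 1 and 0 of the machine with a bag.
\<close>

lemma bag_print_prob_average:
  assumes M: "weakly_realizes gamma_call M \<phi>" and l: "l \<in> {0<..<1}"
  defines "A \<equiv> (LBINT w=0..l. \<phi> w)"
  shows "0 < A" "A < l"
    "bag_print_prob M l [1] = ennreal ((1 / l) * A)" "bag_print_prob M l [0] = ennreal (1 - (1 / l) * A)"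
proof -
  have \<phi>: "\<phi> w \<in> {0<..<1}" "print_prob M w [1] start = ennreal (\<phi> w)" "print_prob M w [0] start = ennreal (1 - \<phi> w)"
    if "w \<in> {0<..<1}" for w
    using M that unfolding gamma_weakly_realizes_iff by auto
  define A' where "A' = (LBINT w=0..l. 1 - \<phi> w)"
  have A: "(\<integral>\<^sup>+ w\<in>{0<..<l}. print_prob M w [1] start \<partial>lborel) = ennreal A" "0 < A"
    unfolding A_def by (rule nn_integral_eq_LBINT[OF measurable_print_prob l]; use \<phi> in simp)+
  have A': "(\<integral>\<^sup>+ w\<in>{0<..<l}. print_prob M w [0] start \<partial>lborel) = ennreal A'" "0 < A'"
    unfolding A'_def by (rule nn_integral_eq_LBINT[OF measurable_print_prob l]; use \<phi> in simp)+
  have "ennreal (A + A') = (\<integral>\<^sup>+ w. print_prob M w [1] start * indicator {0<..<l} w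
      + print_prob M w [0] start * indicator {0<..<l} w \<partial>lborel)"
    using A A' by (simp add: nn_integral_add ennreal_plus)
  also have "\<dots> = (\<integral>\<^sup>+ w. indicator {0<..<l} w \<partial>lborel)"
    using l \<phi> by (intro nn_integral_cong) (auto simp: indicator_def ennreal_plus[symmetric] less_imp_le simp del: ennreal_plus)
  also have "\<dots> = ennreal l" using l by simp
  finally have sum: "A + A' = l"
    using A A' l by (simp del: ennreal_plus)
  show "0 < A" "A < l" using A A' sum by auto
  have "bag_print_prob M l xs = ennreal (1 / l) * (\<integral>\<^sup>+ w\<in>{0<..<l}. print_prob M w xs start \<partial>lborel)" for xs
    using l by (subst bag_print_prob_eq_integral) (auto intro!: nn_integral_unit_interval_scale)
  then have "bag_print_prob M l [1] = ennreal (1 / l) * ennreal A" "bag_print_prob M l [0] = ennreal (1 / l) * ennreal A'"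
    using A A' by simp_all
  moreover have "1 - (1 / l) * A = (1 / l) * A'"
    using l sum by (auto simp: field_simps)
  ultimately show "bag_print_prob M l [1] = ennreal ((1 / l) * A)" "bag_print_prob M l [0] = ennreal (1 - (1 / l) * A)"
    using l A A' by (simp_all add: ennreal_mult[symmetric])
qed

lemma bag_weakly_realizes_average:
  assumes "weakly_realizes gamma_call M \<phi>"
  shows "weakly_realizes bag_gamma_call M (\<lambda>l. (1 / l) * (LBINT w=0..l. \<phi> w))"
  unfolding bag_weakly_realizes_iff
proof (intro ballI conjI)
  fix l :: real assume l: "l \<in> {0<..<1}"
  note avg = bag_print_prob_average[OF assms l]
  show "(1 / l) * (LBINT w=0..l. \<phi> w) \<in> {0<..<1}"
    using l avg(1,2) by simp
qed (rule bag_print_prob_average[OF assms]; assumption)+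

text \<open>
  Each read of the original machine is charged with the three flips that bound the mean cost of a call to
  the bag; averaging over the parameter then applies with a constant price.
\<close>

lemma expected_flips_bag_le:
  assumes l: "l \<in> {0<..<1}"
  shows "expected_flips bag_gamma_call M l \<le> ennreal (3 / l)
    * (\<integral>\<^sup>+ w\<in>{0<..<l}. (expected_flips gamma_call M w + expected_reads gamma_call M w) \<partial>lborel)"
proof -
  define F where "F w = (SUP n. payoff M (\<lambda>_. 0) 1 0 w n start)" for w
  define R where "R w = (SUP n. payoff M (\<lambda>_. 0) 0 1 w n start)" for w
  have [measurable]: "F \<in> borel_measurable borel" "R \<in> borel_measurable borel"
    unfolding F_def R_def by measurable
  have "bag_payoff M (\<lambda>_. 0) 1 bag_cost l n Map.empty start
      \<le> (\<integral>\<^sup>+ x. 3 * (F (l * x) + R (l * x)) \<partial>unit_interval)" for n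
  proof -
    have "bag_payoff M (\<lambda>_. 0) 1 bag_cost l n Map.empty start
        \<le> bag_payoff M (\<lambda>_. 0) 1 (\<lambda>_. 3) l n Map.empty start"
      by (rule bag_payoff_mono_cost) (rule bag_cost_le)
    also have "\<dots> = (\<integral>\<^sup>+ x. payoff M (\<lambda>_. 0) 1 3 (l * x) n start \<partial>unit_interval)"
      using l by (simp add: bag_payoff_eq_integral)
    also have "\<dots> \<le> (\<integral>\<^sup>+ x. 3 * (F (l * x) + R (l * x)) \<partial>unit_interval)"
    proof (rule nn_integral_mono)
      fix x
      have "payoff M (\<lambda>_. 0) 1 3 (l * x) n start
          = 1 * payoff M (\<lambda>_. 0) 1 0 (l * x) n start + 3 * payoff M (\<lambda>_. 0) 0 1 (l * x) n start"
        by (simp add: payoff_linear)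
      also have "\<dots> \<le> 3 * F (l * x) + 3 * R (l * x)"
        unfolding F_def R_def by (intro add_mono mult_mono SUP_upper) auto
      finally show "payoff M (\<lambda>_. 0) 1 3 (l * x) n start \<le> 3 * (F (l * x) + R (l * x))"
        by (simp add: distrib_left)
    qed
    finally show ?thesis .
  qed
  then have "expected_flips bag_gamma_call M l \<le> (\<integral>\<^sup>+ x. 3 * (F (l * x) + R (l * x)) \<partial>unit_interval)"
    using l by (subst expected_flips_bag) (auto intro: SUP_least)
  also have "\<dots> = ennreal (1 / l) * (\<integral>\<^sup>+ w\<in>{0<..<l}. 3 * (F w + R w) \<partial>lborel)"
    using l by (intro nn_integral_unit_interval_scale[where f = "\<lambda>w. 3 * (F w + R w)"]) auto
  also have "\<dots> = ennreal (3 / l) * (\<integral>\<^sup>+ w\<in>{0<..<l}. (F w + R w) \<partial>lborel)"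
  proof -
    have "ennreal (1 / l) * 3 = ennreal (3 / l)"
      using l ennreal_mult[of "1 / l" 3] by simp
    then show ?thesis
      by (simp add: mult.assoc nn_integral_cmult del: distrib_left_numeral) (simp add: mult.assoc[symmetric])
  qed
  also have "(\<integral>\<^sup>+ w\<in>{0<..<l}. (F w + R w) \<partial>lborel)
      = (\<integral>\<^sup>+ w\<in>{0<..<l}. (expected_flips gamma_call M w + expected_reads gamma_call M w) \<partial>lborel)"
    using l by (intro nn_integral_cong)
      (auto simp: indicator_def F_def R_def expected_flips_gamma expected_reads_gamma)
  finally show ?thesis .
qed

text \<open>
  The outputs 1 and 0 exclude each other, so lower bounds for their probabilities that add up to 1 are
  attained. A program without a \<open>Flip\<close> instruction makes no flips, however long it runs.
\<close>

lemma realizesI_lower_bounds: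
  assumes noflip: "\<And>r. Flip r \<notin> set P"
    and \<psi>: "\<And>l. l \<in> {0<..<1} \<Longrightarrow> \<psi> l \<in> {0<..<1}"
    and w1: "\<And>l. l \<in> {0<..<1} \<Longrightarrow> ennreal (\<psi> l) \<le> print_prob P l [1] start"
    and w0: "\<And>l. l \<in> {0<..<1} \<Longrightarrow> ennreal (1 - \<psi> l) \<le> print_prob P l [0] start"
  shows "realizes gamma_call P \<psi>"
  unfolding realizes_def
proof
  show "weakly_realizes gamma_call P \<psi>"
    unfolding gamma_weakly_realizes_iff
  proof (intro ballI)
    fix l :: real assume l: "l \<in> {0<..<1}"
    interpret S: prob_space "samples l" by (rule prob_space_samples)
    let ?m = "\<lambda>x. measure (samples l) {\<omega>. outputs gamma_call P \<omega> [x]}"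
    have sets: "{\<omega>. outputs gamma_call P \<omega> xs} \<in> sets (samples l)" for xs
      using l by (intro sets_gamma_outputs) auto
    have print_prob: "print_prob P l [x] start = ennreal (?m x)" for x
      using l by (simp add: emeasure_gamma_outputs[symmetric] S.emeasure_eq_measure)
    have "?m 1 + ?m 0 = measure (samples l) ({\<omega>. outputs gamma_call P \<omega> [1]} \<union> {\<omega>. outputs gamma_call P \<omega> [0]})"
      by (rule S.finite_measure_Union[symmetric, OF sets sets]) (auto dest: outputs_unique)
    also have "\<dots> \<le> 1" by simp
    finally have "?m 1 + ?m 0 \<le> 1" .
    moreover have "\<psi> l \<le> ?m 1" "1 - \<psi> l \<le> ?m 0"
      using w1[OF l] w0[OF l] by (simp_all add: print_prob)
    ultimately have "?m 1 = \<psi> l" "?m 0 = 1 - \<psi> l" by auto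
    then show "\<psi> l \<in> {0<..<1} \<and> print_prob P l [1] start = ennreal (\<psi> l) \<and> print_prob P l [0] start = ennreal (1 - \<psi> l)"
      using \<psi>[OF l] by (simp add: print_prob)
  qed
  have "payoff P (\<lambda>_. 0) 1 0 p n m = 0" for p n m
  proof (induction n arbitrary: m)
    case (Suc n)
    have "P ! fst m \<noteq> Flip r" if "fst m < length P" for r
      using noflip[of r] nth_mem[OF that] by auto
    then have "node_of P m \<noteq> Coin k" for k
      by (cases m; cases "P ! fst m") (auto split: if_splits, blast)
    then show ?case
      by (cases "node_of P m") (auto simp: Suc mix_def)
  qed simp
  then show "\<forall>l\<in>{0<..<1}. expected_flips gamma_call P l < \<infinity>"
    by (simp add: expected_flips_gamma)
qed

section \<open>Symbolic execution of programs\<close>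

lemma print_prob_Suc: "print_prob P p xs m = (SUP n. payoff P (prints P xs) 0 0 p (Suc n) m)"
  unfolding print_prob_def
proof (rule antisym)
  show "(SUP n. payoff P (prints P xs) 0 0 p n m) \<le> (SUP n. payoff P (prints P xs) 0 0 p (Suc n) m)"
    by (intro SUP_mono' payoff_prints_mono)
  show "(SUP n. payoff P (prints P xs) 0 0 p (Suc n) m) \<le> (SUP n. payoff P (prints P xs) 0 0 p n m)"
    by (intro SUP_least SUP_upper) simp
qed

text \<open>
  The probability of printing \<open>xs\<close> eventually is harmonic along the execution. Programs with loops can
  therefore be analysed by solving equations, without any reference to running times.
\<close>

lemma print_prob_step:
  "print_prob P p xs m =
     (case node_of P m of
        Done \<Rightarrow> prints P xs m
      | Quiet m' \<Rightarrow> print_prob P p xs m'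
      | Coin k \<Rightarrow> mix (1/2) (\<lambda>b. print_prob P p xs (k b))
      | Query k \<Rightarrow> mix p (\<lambda>b. print_prob P p xs (k b)))"
  by (subst print_prob_Suc, cases "node_of P m")
    (simp_all add: print_prob_def mix_SUP[OF incseq_payoff_prints])

lemma print_prob_le_1:
  assumes "0 \<le> p" "p \<le> 1"
  shows "print_prob P p xs m \<le> 1"
proof -
  have "payoff P (prints P xs) 0 0 p n m \<le> 1" for n
  proof (induction n arbitrary: m)
    case 0
    show ?case by (simp add: prints_def)
  next
    case (Suc n)
    have "mix r (\<lambda>b. payoff P (prints P xs) 0 0 p n (k b)) \<le> 1" if "0 \<le> r" "r \<le> 1" for r k
      using mix_mono[of "\<lambda>b. payoff P (prints P xs) 0 0 p n (k b)" "\<lambda>_. 1" r] Suc mix_const[OF that, of 1]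
      by simp
    then show ?case
      using assms by (cases "node_of P m") (simp_all add: Suc, simp add: prints_def)
  qed
  then show ?thesis unfolding print_prob_def by (intro SUP_least)
qed

definition code_at :: "program \<Rightarrow> nat \<Rightarrow> instr list \<Rightarrow> bool" where
  "code_at P s is \<longleftrightarrow> (\<forall>k<length is. s + k < length P \<and> P ! (s + k) = is ! k)"

lemma code_at_append: "code_at P s (xs @ ys) \<longleftrightarrow> code_at P s xs \<and> code_at P (s + length xs) ys"
proof
  assume *: "code_at P s (xs @ ys)"
  show "code_at P s xs \<and> code_at P (s + length xs) ys"
    unfolding code_at_def
  proof (intro conjI allI impI)
    fix k
    show "k < length xs \<Longrightarrow> s + k < length P" "k < length xs \<Longrightarrow> P ! (s + k) = xs ! k"
      using * by (auto simp: code_at_def nth_append dest!: spec[of _ k])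
    show "k < length ys \<Longrightarrow> s + length xs + k < length P"
        "k < length ys \<Longrightarrow> P ! (s + length xs + k) = ys ! k"
      using * by (auto simp: code_at_def nth_append add.assoc dest!: spec[of _ "length xs + k"])
  qed
next
  assume *: "code_at P s xs \<and> code_at P (s + length xs) ys"
  show "code_at P s (xs @ ys)"
    unfolding code_at_def
  proof (intro allI impI)
    fix k assume k: "k < length (xs @ ys)"
    show "s + k < length P \<and> P ! (s + k) = (xs @ ys) ! k"
      using * k
      by (cases "k < length xs")
        (auto simp: code_at_def nth_append dest: spec[of _ k] spec[of _ "k - length xs"])
  qed
qed

text \<open>
  Symbolic execution of one instruction. The successor of address \<open>s + k\<close> is written \<open>s + (k + 1)\<close> so
  that, for a numeral \<open>k\<close>, simplification returns it to the form \<open>s\<close> plus a numeral.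
\<close>

lemma print_prob_code:
  assumes "code_at P s is" "k < length is"
  shows "print_prob P p xs (s + k, R, q) =
    (case is ! k of
        Const r c \<Rightarrow> print_prob P p xs (s + (k + 1), R(r := c), q)
      | Arith f r x y \<Rightarrow> print_prob P p xs (s + (k + 1), R(r := arith_op f (R x) (R y)), q)
      | JumpIfZero r l \<Rightarrow> print_prob P p xs (if R r = 0 then l else s + (k + 1), R, q)
      | Flip r \<Rightarrow> mix (1/2) (\<lambda>b. print_prob P p xs (s + (k + 1), R(r := of_bool b), q))
      | Input r \<Rightarrow> mix p (\<lambda>b. print_prob P p xs (s + (k + 1), R(r := of_bool b), q))
      | Output r \<Rightarrow> print_prob P p xs (s + (k + 1), R, q @ [R r]))"
proof -
  have "s + k < length P" "P ! (s + k) = is ! k"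
    using assms by (auto simp: code_at_def)
  then show ?thesis
    by (subst print_prob_step) (auto split: instr.split)
qed

section \<open>Fair bits from a biased generator\<close>

text \<open>
  Von Neumann's procedure, placed at address \<open>s\<close>: call the generator twice until the two answers differ,
  then return the second of them in \<open>r\<close>. Register \<open>z\<close> holds 0, so a jump on \<open>z\<close> is unconditional.
\<close>

definition fair_coin :: "nat \<Rightarrow> nat \<Rightarrow> nat \<Rightarrow> instr list" where
  "fair_coin z s r =
    [Input r, JumpIfZero r (s + 5),
     Input r, JumpIfZero r (s + 7), JumpIfZero z s,
     Input r, JumpIfZero r s]"

lemma length_fair_coin[simp]: "length (fair_coin z s r) = 7"
  by (simp add: fair_coin_def)

text \<open>
  Equal answers lead back to the start, whence a linear equation for \<open>x\<close>. The bound on \<open>x\<close> excludes its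
  other solution, infinity.
\<close>

lemma von_neumann_fixpoint:
  fixes x :: ennreal
  assumes p: "p \<in> {0<..<1}" and le: "x \<le> 1" "\<And>b. y b \<le> 1"
    and x: "x = mix p (\<lambda>b. mix p (\<lambda>c. if b = c then x else y c))"
  shows "x = mix (1/2) y"
proof -
  (* The equation is solved in the reals, where terms can be subtracted. *)
  define \<xi> where "\<xi> = enn2real x"
  define \<eta> where "\<eta> b = enn2real (y b)" for b
  have "x < \<top>" "y b < \<top>" for b
    using le by (meson ennreal_one_less_top le_less_trans)+
  then have e: "x = ennreal \<xi>" "y b = ennreal (\<eta> b)" and nn: "0 \<le> \<xi>" "0 \<le> \<eta> b" for b
    by (simp_all add: \<xi>_def \<eta>_def)
  have "ennreal \<xi> = ennreal (p * (p * \<xi> + (1 - p) * \<eta> False) + (1 - p) * (p * \<eta> True + (1 - p) * \<xi>))"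
    using x p nn unfolding e mix_def by (simp add: ennreal_mult'[symmetric] ennreal_plus[symmetric] del: ennreal_plus)
  then have "\<xi> = p * (p * \<xi> + (1 - p) * \<eta> False) + (1 - p) * (p * \<eta> True + (1 - p) * \<xi>)"
    using p nn by (subst (asm) ennreal_inj) auto
  then have "2 * (p * (1 - p)) * \<xi> = (p * (1 - p)) * (\<eta> True + \<eta> False)"
    by (simp add: algebra_simps)
  then have "\<xi> = 1/2 * \<eta> True + 1/2 * \<eta> False"
    using p by simp
  then have "x = ennreal (1/2 * \<eta> True + 1/2 * \<eta> False)"
    using e(1) by simp
  also have "\<dots> = ennreal (1/2) * y True + ennreal (1/2) * y False"
    unfolding e using nn by (simp only: ennreal_plus ennreal_mult mult_nonneg_nonneg divide_nonneg_pos zero_le_one zero_less_numeral)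
  finally show ?thesis by (simp add: mix_def)
qed

text \<open>
  A restart finds the same situation as the first attempt, since the only register that has changed is
  \<open>r\<close>, which the first instruction overwrites.
\<close>

lemma fair_coin_correct:
  assumes code: "code_at P s (fair_coin z s r)" and p: "p \<in> {0<..<1}" and z: "R z = 0" "r \<noteq> z"
  shows "print_prob P p xs (s, R, q) = mix (1/2) (\<lambda>b. print_prob P p xs (s + 7, R(r := of_bool b), q))"
proof -
  note at = print_prob_code[OF code, of _ p xs _ q]
  have at0: "print_prob P p xs (s, R, q) = mix p (\<lambda>b. print_prob P p xs (Suc s, R(r := of_bool b), q))" for R
    using at[of 0 R] by (simp add: fair_coin_def)
  have at1: "print_prob P p xs (Suc s, R, q) = print_prob P p xs (if R r = 0 then s + 5 else Suc (Suc s), R, q)" for R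
    using at[of 1 R] by (simp add: fair_coin_def)
  have at2: "print_prob P p xs (Suc (Suc s), R, q) = mix p (\<lambda>b. print_prob P p xs (s + 3, R(r := of_bool b), q))" for R
    using at[of 2 R] by (simp add: fair_coin_def)
  have at3: "print_prob P p xs (s + 3, R, q) = print_prob P p xs (if R r = 0 then s + 7 else s + 4, R, q)" for R
    using at[of 3 R] by (simp add: fair_coin_def)
  have at4: "print_prob P p xs (s + 4, R, q) = print_prob P p xs (if R z = 0 then s else s + 5, R, q)" for R
    using at[of 4 R] by (simp add: fair_coin_def)
  have at5: "print_prob P p xs (s + 5, R, q) = mix p (\<lambda>b. print_prob P p xs (s + 6, R(r := of_bool b), q))" for R
    using at[of 5 R] by (simp add: fair_coin_def)
  have at6: "print_prob P p xs (s + 6, R, q) = print_prob P p xs (if R r = 0 then s else s + 7, R, q)" for R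
    using at[of 6 R] by (simp add: fair_coin_def)
  have restart: "print_prob P p xs (s, R(r := v), q) = print_prob P p xs (s, R, q)" for v
    by (simp add: at0[of R] at0[of "R(r := v)"])
  have after1: "print_prob P p xs (Suc s, R(r := of_bool b), q)
      = mix p (\<lambda>c. if b = c then print_prob P p xs (s, R, q) else print_prob P p xs (s + 7, R(r := of_bool c), q))" for b
    using z by (cases b) (simp_all add: at1 at2 at3 at4 at5 at6 restart mix_def)
  show ?thesis
    by (rule von_neumann_fixpoint[OF p], rule print_prob_le_1, use p in simp, use p in simp, rule print_prob_le_1,
        use p in simp, use p in simp)
      (subst at0, simp only: after1)
qed

section \<open>The bag as a ternary number\<close>

definition ternary_digit :: "int \<Rightarrow> nat \<Rightarrow> int" where
  "ternary_digit w j = (w div 3 ^ j) mod 3"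

text \<open>
  The whole bag is kept in a single integer, whose ternary digit at position \<open>j\<close> is 0 for an unassigned
  bit and 1 or 2 for an assigned one. The empty bag is the number 0, the initial content of every register.
\<close>

definition encodes :: "int \<Rightarrow> (nat \<Rightarrow> bool option) \<Rightarrow> bool" where
  "encodes w \<beta> \<longleftrightarrow> (\<forall>j. ternary_digit w j = (case \<beta> j of None \<Rightarrow> 0 | Some b \<Rightarrow> 1 + of_bool b))"

text \<open>
  Filling in a digit that is 0 causes no carry, so the other digits stay as they are.
\<close>

lemma ternary_digit_add:
  assumes d: "ternary_digit w j = 0" "0 \<le> d" "d < 3"
  shows "ternary_digit (w + 3 ^ j * d) i = (if i = j then d else ternary_digit w i)"
proof (cases i j rule: linorder_cases)
  case less
  then obtain k where j: "j = i + Suc k" using less_imp_Suc_add by auto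
  have "w + 3 ^ j * d = w + (3 * (3 ^ k * d)) * 3 ^ i"
    by (simp add: j power_add ac_simps)
  then have "(w + 3 ^ j * d) div 3 ^ i = 3 * (3 ^ k * d) + w div 3 ^ i"
    by (simp only: div_mult_self1) simp
  then show ?thesis using less by (simp add: ternary_digit_def)
next
  case equal
  have "(w + 3 ^ j * d) div 3 ^ j = d + w div 3 ^ j" by simp
  then show ?thesis using equal d by (simp add: ternary_digit_def mod_add_right_eq[symmetric, of d])
next
  case greater
  then obtain k where i: "i = Suc j + k" using less_imp_Suc_add by auto
  have pow: "(3::int) ^ i = 3 ^ j * (3 * 3 ^ k)"
    by (simp add: i power_add ac_simps)
  have split: "v div 3 ^ i = (v div 3 ^ j) div 3 div 3 ^ k" for v :: int
    unfolding pow by (simp add: zdiv_zmult2_eq)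
  have "(w + 3 ^ j * d) div 3 ^ j = d + w div 3 ^ j" by simp
  moreover have "(d + a) div 3 = a div 3" if "a mod 3 = 0" for a :: int
    using d(2,3) that by presburger
  ultimately show ?thesis
    using greater d(1) by (simp add: ternary_digit_def split)
qed

lemma encodes_empty: "encodes 0 Map.empty"
  by (simp add: encodes_def ternary_digit_def)

lemma encodes_upd:
  assumes "encodes w \<beta>" "\<beta> j = None"
  shows "encodes (w + 3 ^ j * (of_bool u + 1)) (\<beta>(j \<mapsto> u))"
  using assms ternary_digit_add[of w j "of_bool u + 1"] by (auto simp: encodes_def)

section \<open>Emulating the bag machine without flips\<close>

text \<open>
  The emulation of a call \<open>Input r\<close> to the modified source, for a program whose registers lie below \<open>N\<close>,
  placed at address \<open>s\<close>. Register \<open>N\<close> holds the bag and register \<open>N + 1\<close> the constant 0; \<open>N + 2\<close> holds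
  the power of 3 that belongs to the current position, and \<open>N + 3\<close>, \<open>N + 4\<close> are scratch registers. The
  code is laid out as follows.
  \<^item> The head, at \<open>s\<close>, initializes the power; its last instruction, at \<open>s + 2\<close>, advances to the next
    position and is the entry of the loop that draws the geometric variable.
  \<^item> A fair coin, at \<open>s + 3\<close>, decides whether to stop at this position.
  \<^item> The lookup, at \<open>s + 10\<close>, extracts the digit there.
  \<^item> For an unassigned digit, a fair coin at \<open>s + 15\<close> draws the bit, and the tail, at \<open>s + 22\<close>, stores it.
  \<^item> From \<open>s + 26\<close> on, the bit returned by the bag is multiplied by an answer of the generator.
\<close>

definition bag_call_head :: "nat \<Rightarrow> instr list" where
  "bag_call_head N = [Const (N + 2) 1, Const (N + 3) 3, Arith Mul (N + 2) (N + 2) (N + 3)]"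

definition bag_call_lookup :: "nat \<Rightarrow> nat \<Rightarrow> instr list" where
  "bag_call_lookup N s =
    [JumpIfZero (N + 4) (s + 2),
     Arith Div (N + 4) N (N + 2), Arith Mod (N + 4) (N + 4) (N + 3),
     JumpIfZero (N + 4) (s + 15), JumpIfZero (N + 1) (s + 26)]"

definition bag_call_tail :: "nat \<Rightarrow> nat \<Rightarrow> nat \<Rightarrow> instr list" where
  "bag_call_tail N s r =
    [Const (N + 3) 1, Arith Add (N + 4) (N + 4) (N + 3),
     Arith Mul (N + 2) (N + 2) (N + 4), Arith Add N N (N + 2),
     Const (N + 3) 1, Arith Sub (N + 4) (N + 4) (N + 3),
     Input r, Arith Mul r r (N + 4), JumpIfZero (N + 1) (s + 31)]"

definition bag_call_code :: "nat \<Rightarrow> nat \<Rightarrow> nat \<Rightarrow> instr list" where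
  "bag_call_code N s r =
    bag_call_head N @ fair_coin (N + 1) (s + 3) (N + 4) @
    bag_call_lookup N s @ fair_coin (N + 1) (s + 15) (N + 4) @
    bag_call_tail N s r"

lemma length_bag_call_parts[simp]:
  "length (bag_call_head N) = 3" "length (bag_call_lookup N s) = 5" "length (bag_call_tail N s r) = 9"
  by (simp_all add: bag_call_head_def bag_call_lookup_def bag_call_tail_def)

text \<open>
  The code for one instruction of the emulated program, placed at address \<open>s\<close>. All blocks are padded to
  the length 31 of the longest one, the block for \<open>Input\<close>, so that the block of instruction \<open>l\<close> starts
  at \<open>off + 31 * l\<close> and jump targets can be translated independently of the code in between. A jump
  beyond the end of the program leads beyond the end of the emulator.
\<close>

fun block :: "nat \<Rightarrow> nat \<Rightarrow> nat \<Rightarrow> instr \<Rightarrow> instr list" where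
  "block N off s (Flip r) = fair_coin (N + 1) s r @ [JumpIfZero (N + 1) (s + 31)]"
| "block N off s (Input r) = bag_call_code N s r"
| "block N off s (JumpIfZero r l) = [JumpIfZero r (off + 31 * l), JumpIfZero (N + 1) (s + 31)]"
| "block N off s I = [I, JumpIfZero (N + 1) (s + 31)]"

fun instr_regs :: "instr \<Rightarrow> nat set" where
  "instr_regs (Const r k) = {r}"
| "instr_regs (Arith f r x y) = {r, x, y}"
| "instr_regs (JumpIfZero r l) = {r}"
| "instr_regs (Flip r) = {r}"
| "instr_regs (Input r) = {r}"
| "instr_regs (Output r) = {r}"

text \<open>
  The registers below \<open>N\<close> are those of the emulated program, with content \<open>R\<close>; the emulator's own
  registers start at \<open>N\<close>.
\<close>

definition represents ::
  "nat \<Rightarrow> (nat \<Rightarrow> bool option) \<Rightarrow> (nat \<Rightarrow> int) \<Rightarrow> (nat \<Rightarrow> int) \<Rightarrow> bool" where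
  "represents N \<beta> R R' \<longleftrightarrow> (\<forall>x<N. R' x = R x) \<and> R' (N + 1) = 0 \<and> encodes (R' N) \<beta>"

lemma represents_scratch:
  "2 \<le> i \<Longrightarrow> represents N \<beta> R (R'(N + i := v)) \<longleftrightarrow> represents N \<beta> R R'"
  by (auto simp: represents_def)

lemma represents_upd:
  "represents N \<beta> R R' \<Longrightarrow> r < N \<Longrightarrow> represents N \<beta> (R(r := v)) (R'(r := v))"
  by (auto simp: represents_def)

lemma print_prob_code_offset:
  assumes "code_at P (s + d) is" "k < length is"
  shows "print_prob P p xs (s + (d + k), R, q) =
    (case is ! k of
        Const r c \<Rightarrow> print_prob P p xs (s + (d + (k + 1)), R(r := c), q)
      | Arith f r x y \<Rightarrow> print_prob P p xs (s + (d + (k + 1)), R(r := arith_op f (R x) (R y)), q)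
      | JumpIfZero r l \<Rightarrow> print_prob P p xs (if R r = 0 then l else s + (d + (k + 1)), R, q)
      | Flip r \<Rightarrow> mix (1/2) (\<lambda>b. print_prob P p xs (s + (d + (k + 1)), R(r := of_bool b), q))
      | Input r \<Rightarrow> mix p (\<lambda>b. print_prob P p xs (s + (d + (k + 1)), R(r := of_bool b), q))
      | Output r \<Rightarrow> print_prob P p xs (s + (d + (k + 1)), R, q @ [R r]))"
  using print_prob_code[OF assms] by (simp only: add.assoc)

text \<open>
  Here \<open>X v \<beta>\<close> is a lower bound for the probability of printing \<open>xs\<close> once the call has stored \<open>v\<close> in \<open>r\<close>
  and left the bag in state \<open>\<beta>\<close>. An inequality is all that is needed, and it can be proved by unrolling
  the loop for the geometric variable finitely often.
\<close>

lemma bag_call_code_correct: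
  fixes X :: "bool \<Rightarrow> (nat \<Rightarrow> bool option) \<Rightarrow> ennreal"
  assumes code: "code_at P s (bag_call_code N s r)" and p: "p \<in> {0<..<1}" and r: "r < N"
    and R: "represents N \<beta> R R'"
    and post: "\<And>v \<beta> R'. represents N \<beta> (R(r := of_bool v)) R' \<Longrightarrow> X v \<beta> \<le> print_prob P p xs (s + 31, R', q)"
  shows "bag_mix \<beta> (\<lambda>u \<beta>'. mix p (\<lambda>g. X (u \<and> g) \<beta>')) \<le> print_prob P p xs (s, R', q)"
proof -
  define Y where "Y u \<beta> = mix p (\<lambda>g. X (u \<and> g) \<beta>)" for u \<beta>
  have head: "code_at P s (bag_call_head N)"
    and coin1: "code_at P (s + 3) (fair_coin (N + 1) (s + 3) (N + 4))"
    and lookup: "code_at P (s + 10) (bag_call_lookup N s)"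
    and coin2: "code_at P (s + 15) (fair_coin (N + 1) (s + 15) (N + 4))"
    and tail: "code_at P (s + 22) (bag_call_tail N s r)"
    using code by (simp_all add: bag_call_code_def code_at_append add.commute)
  note h = print_prob_code[OF head, of _ p xs _ q] and k = print_prob_code_offset[OF lookup, of _ p xs _ q]
    and t = print_prob_code_offset[OF tail, of _ p xs _ q]
  have toss1: "print_prob P p xs (s + 3, R, q) = mix (1/2) (\<lambda>b. print_prob P p xs (s + 10, R(N + 4 := of_bool b), q))"
    and toss2: "print_prob P p xs (s + 15, R, q) = mix (1/2) (\<lambda>b. print_prob P p xs (s + 22, R(N + 4 := of_bool b), q))"
    if "R (N + 1) = 0" for R
    using fair_coin_correct[OF coin1 p, of R xs q] fair_coin_correct[OF coin2 p, of R xs q] that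
    by (simp_all add: add.commute)

  (* The digit is at hand as 1 or 2, and the answer of the generator is multiplied in. *)
  have answer: "Y u \<beta> \<le> print_prob P p xs (s + 26, R', q)"
    if rep: "represents N \<beta> R R'" and dig: "R' (N + 4) = 1 + of_bool u" for u \<beta> R'
  proof -
    let ?R = "R'(N + 3 := 1, N + 4 := of_bool u)"
    have "print_prob P p xs (s + 26, R', q)
        = print_prob P p xs (s + 28, ?R, q)"
      using t[of 4 R'] t[of 5 "R'(N + 3 := 1)"] dig by (simp add: bag_call_tail_def)
    also have "\<dots> = mix p (\<lambda>g. print_prob P p xs (s + 29, ?R(r := of_bool g), q))"
      using t[of 6 ?R] by (simp add: bag_call_tail_def)
    also have "\<dots> = mix p (\<lambda>g. print_prob P p xs (s + 31, ?R(r := of_bool (u \<and> g)), q))"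
    proof (intro arg_cong2[where f = mix] refl ext)
      fix g
      have "?R (N + 1) = 0" using rep by (simp add: represents_def)
      then show "print_prob P p xs (s + 29, ?R(r := of_bool g), q) = print_prob P p xs (s + 31, ?R(r := of_bool (u \<and> g)), q)"
        using t[of 7 "?R(r := of_bool g)"] t[of 8 "?R(r := of_bool (u \<and> g))"] r
        by (simp add: bag_call_tail_def of_bool_conj mult.commute)
    qed
    also have "Y u \<beta> \<le> \<dots>"
      unfolding Y_def
      by (intro mix_mono post represents_upd[OF _ r]) (simp add: represents_scratch rep)
    finally show ?thesis .
  qed

  define hit where "hit j = (case \<beta> j of Some u \<Rightarrow> Y u \<beta> | None \<Rightarrow> mix (1/2) (\<lambda>u. Y u (\<beta>(j \<mapsto> u))))" for j
  (* The geometric variable has been drawn, so position j is final. *)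
  have hit: "hit j \<le> print_prob P p xs (s + 11, R', q)"
    if rep: "represents N \<beta> R R'" and pow: "R' (N + 2) = 3 ^ j" "R' (N + 3) = 3" for j R'
  proof -
    let ?d = "ternary_digit (R' N) j"
    let ?R = "R'(N + 4 := ?d)"
    have rep': "represents N \<beta> R ?R" by (simp add: represents_scratch rep)
    have z: "?R (N + 1) = 0" and enc: "encodes (R' N) \<beta>"
      using rep by (simp_all add: represents_def)
    have start: "print_prob P p xs (s + 11, R', q) = print_prob P p xs (s + 13, ?R, q)"
      using k[of 1 R'] k[of 2 "R'(N + 4 := R' N div R' (N + 2))"] pow
      by (simp add: bag_call_lookup_def ternary_digit_def)
    show ?thesis
    proof (cases "\<beta> j")
      case (Some u)
      then have d: "?d = 1 + of_bool u" using enc by (simp add: encodes_def)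
      then have "print_prob P p xs (s + 13, ?R, q) = print_prob P p xs (s + 26, ?R, q)"
        using k[of 3 ?R] k[of 4 ?R] z by (simp add: bag_call_lookup_def)
      then show ?thesis
        using answer[OF rep', of u] d Some by (simp add: start hit_def)
    next
      case None
      then have d: "?d = 0" using enc by (simp add: encodes_def)
      then have "print_prob P p xs (s + 13, ?R, q) = print_prob P p xs (s + 15, ?R, q)"
        using k[of 3 ?R] by (simp add: bag_call_lookup_def)
      also have "\<dots> = mix (1/2) (\<lambda>u. print_prob P p xs (s + 22, ?R(N + 4 := of_bool u), q))"
        using toss2[of ?R] z by simp
      also have "mix (1/2) (\<lambda>u. Y u (\<beta>(j \<mapsto> u))) \<le> \<dots>"
      proof (rule mix_mono)
        fix u
        (* The new digit u + 1 is scaled by the power of 3 and added to the number that encodes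
           the bag; R1, R2, R3 are the successive contents of the registers. *)
        let ?R1 = "R'(N + 4 := of_bool u, N + 3 := 1)"
        let ?R2 = "?R1(N + 4 := of_bool u + 1, N + 2 := 3 ^ j * (of_bool u + 1))"
        let ?R3 = "?R2(N := R' N + 3 ^ j * (of_bool u + 1))"
        have "print_prob P p xs (s + 22, ?R(N + 4 := of_bool u), q) = print_prob P p xs (s + 24, ?R1(N + 4 := of_bool u + 1), q)"
          using t[of 0 "?R(N + 4 := of_bool u)"] t[of 1 ?R1] by (simp add: bag_call_tail_def)
        also have "\<dots> = print_prob P p xs (s + 26, ?R3, q)"
          using t[of 2 "?R1(N + 4 := of_bool u + 1)"] t[of 3 ?R2] pow by (simp add: bag_call_tail_def)
        also have "Y u (\<beta>(j \<mapsto> u)) \<le> \<dots>"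
        proof (rule answer)
          show "represents N (\<beta>(j \<mapsto> u)) R ?R3"
            using rep encodes_upd[OF enc None, of u] by (simp add: represents_def)
        qed simp
        finally show "Y u (\<beta>(j \<mapsto> u)) \<le> print_prob P p xs (s + 22, ?R(N + 4 := of_bool u), q)" .
      qed
      finally show ?thesis unfolding start hit_def None option.case .
    qed
  qed

  (* The loop at s + 2 about to advance from position j. Unrolled n times, it reaches the
     positions j + 1, ..., j + n. *)
  have loop: "(\<Sum>i<n. ennreal ((1/2) ^ Suc i) * hit (Suc (j + i))) \<le> print_prob P p xs (s + 2, R', q)"
    if "represents N \<beta> R R'" "R' (N + 2) = 3 ^ j" "R' (N + 3) = 3" for n j R'
    using that
  proof (induction n arbitrary: j R')
    case 0
    show ?case by simp
  next
    case (Suc n)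
    let ?R = "\<lambda>b. R'(N + 2 := 3 ^ Suc j, N + 4 := of_bool b)"
    have rep: "represents N \<beta> R (?R b)" for b
      using Suc.prems(1) by (simp add: represents_scratch represents_scratch[of 2, simplified])
    have z: "R' (N + 1) = 0" using Suc.prems(1) by (simp add: represents_def)
    have "print_prob P p xs (s + 2, R', q) = mix (1/2) (\<lambda>b. print_prob P p xs (s + 10, ?R b, q))"
      using h[of 2 R'] toss1[of "R'(N + 2 := 3 ^ Suc j)"] Suc.prems(2,3) z
      by (simp add: bag_call_head_def mult.commute)
    also have "\<dots> = mix (1/2) (\<lambda>b. print_prob P p xs (if b then s + 11 else s + 2, ?R b, q))"
    proof (intro arg_cong2[where f = mix] refl ext)
      fix b
      show "print_prob P p xs (s + 10, ?R b, q) = print_prob P p xs (if b then s + 11 else s + 2, ?R b, q)"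
        using k[of 0 "?R b"] by (simp add: bag_call_lookup_def)
    qed
    finally have step: "print_prob P p xs (s + 2, R', q)
        = mix (1/2) (\<lambda>b. print_prob P p xs (if b then s + 11 else s + 2, ?R b, q))" .
    have "(\<Sum>i<Suc n. ennreal ((1/2) ^ Suc i) * hit (Suc (j + i)))
        = ennreal (1/2) * hit (Suc j) + (\<Sum>i<n. ennreal ((1/2) ^ Suc (Suc i)) * hit (Suc (j + Suc i)))"
      by (subst sum.lessThan_Suc_shift) simp
    also have "(\<Sum>i<n. ennreal ((1/2) ^ Suc (Suc i)) * hit (Suc (j + Suc i)))
        = ennreal (1/2) * (\<Sum>i<n. ennreal ((1/2) ^ Suc i) * hit (Suc (Suc j + i)))"
    proof -
      have "ennreal ((1/2) ^ Suc (Suc i)) = ennreal (1/2) * ennreal ((1/2) ^ Suc i)" for i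
        by (subst ennreal_mult[symmetric]) simp_all
      then show ?thesis by (simp only: sum_distrib_left mult.assoc add_Suc add_Suc_right)
    qed
    also have "ennreal (1/2) * hit (Suc j) + ennreal (1/2) * (\<Sum>i<n. ennreal ((1/2) ^ Suc i) * hit (Suc (Suc j + i)))
        = mix (1/2) (\<lambda>b. if b then hit (Suc j) else (\<Sum>i<n. ennreal ((1/2) ^ Suc i) * hit (Suc (Suc j + i))))"
      by (simp add: mix_def)
    also have "\<dots> \<le> mix (1/2) (\<lambda>b. print_prob P p xs (if b then s + 11 else s + 2, ?R b, q))"
    proof (rule mix_mono)
      fix b
      show "(if b then hit (Suc j) else (\<Sum>i<n. ennreal ((1/2) ^ Suc i) * hit (Suc (Suc j + i))))
          \<le> print_prob P p xs (if b then s + 11 else s + 2, ?R b, q)"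
      proof (cases b)
        case True
        have "hit (Suc j) \<le> print_prob P p xs (s + 11, ?R b, q)"
          by (rule hit[OF rep]) (simp_all add: Suc.prems(3))
        then show ?thesis unfolding if_P[OF True] .
      next
        case False
        have "(\<Sum>i<n. ennreal ((1/2) ^ Suc i) * hit (Suc (Suc j + i))) \<le> print_prob P p xs (s + 2, ?R b, q)"
          by (rule Suc.IH[OF rep]) (simp_all add: Suc.prems(3))
        then show ?thesis unfolding if_not_P[OF False] .
      qed
    qed
    finally show ?case unfolding step .
  qed

  have "bag_mix \<beta> Y = (SUP n. \<Sum>i<n. ennreal ((1/2) ^ Suc i) * hit (Suc i))"
    by (simp only: bag_mix_def suminf_eq_SUP hit_def)
  also have "\<dots> \<le> print_prob P p xs (s + 2, R'(N + 2 := 1, N + 3 := 3), q)"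
    using loop[of "R'(N + 2 := 1, N + 3 := 3)" 0] R
    by (intro SUP_least) (simp add: represents_scratch represents_scratch[of 2, simplified])
  also have "\<dots> = print_prob P p xs (s, R', q)"
    using h[of 0 R'] h[of 1 "R'(N + 2 := 1)"] by (simp add: bag_call_head_def)
  finally show ?thesis unfolding Y_def[abs_def] .
qed

text \<open>
  One step of the emulated machine corresponds to the execution of a whole block. As the block may take
  any number of steps, the probability on the right refers to the emulator's entire future.
\<close>

lemma emulation:
  assumes p: "p \<in> {0<..<1}" and len: "length P = off + 31 * length M"
    and code: "\<And>i. i < length M \<Longrightarrow> code_at P (off + 31 * i) (block N off (off + 31 * i) (M ! i))"
    and regs: "\<And>I. I \<in> set M \<Longrightarrow> instr_regs I \<subseteq> {..<N}"
    and rep: "represents N \<beta> R R'"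
  shows "bag_payoff M (prints M xs) 0 (\<lambda>_. 0) p n \<beta> (i, R, q) \<le> print_prob P p xs (off + 31 * i, R', q)"
  using rep
proof (induction n arbitrary: \<beta> i R R' q)
  case 0
  show ?case
  proof (cases "i < length M")
    case False
    then show ?thesis by (subst print_prob_step) (simp add: prints_def len)
  qed (simp add: prints_def)
next
  case (Suc n)
  let ?s = "off + 31 * i"
  let ?v = "bag_payoff M (prints M xs) 0 (\<lambda>_. 0) p n"
  show ?case
  proof (cases "i < length M")
    case False
    then show ?thesis by (subst print_prob_step) (simp add: prints_def len)
  next
    case True
    note at = print_prob_code[OF code[OF True], of _ p xs _ q]
    have z: "R' (N + 1) = 0" and same: "\<And>x. x < N \<Longrightarrow> R' x = R x"
      using Suc.prems by (simp_all add: represents_def)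
    have regs_i: "instr_regs (M ! i) \<subseteq> {..<N}" by (rule regs) (use True in simp)
    have after: "off + 31 * Suc i = ?s + 31" by simp
    have upd: "?v \<beta> (Suc i, R(r := c), q) \<le> print_prob P p xs (?s + 31, R'(r := c), q)" if "r < N" for r c
      using Suc.IH[OF represents_upd[OF Suc.prems that], of "Suc i" c q] unfolding after .
    show ?thesis
    proof (cases "M ! i")
      case (Const r c)
      then have "print_prob P p xs (?s, R', q) = print_prob P p xs (?s + 31, R'(r := c), q)"
        using at[of 0 R'] at[of 1 "R'(r := c)"] z regs_i by simp
      then show ?thesis using upd[of r c] Const regs_i True by simp
    next
      case (Arith f r x y)
      let ?c = "arith_op f (R x) (R y)"
      have "print_prob P p xs (?s, R', q) = print_prob P p xs (?s + 31, R'(r := ?c), q)"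
        using at[of 0 R'] at[of 1 "R'(r := ?c)"] z regs_i same[of x] same[of y] Arith by simp
      then show ?thesis using upd[of r ?c] Arith regs_i True by simp
    next
      case (JumpIfZero r l)
      have "print_prob P p xs (?s, R', q) = print_prob P p xs (if R r = 0 then off + 31 * l else ?s + 31, R', q)"
        using at[of 0 R'] at[of 1 R'] z regs_i same[of r] JumpIfZero by simp
      then show ?thesis
        using Suc.IH[OF Suc.prems, of l q] Suc.IH[OF Suc.prems, of "Suc i" q] JumpIfZero True
        unfolding after by simp
    next
      case (Output r)
      have "print_prob P p xs (?s, R', q) = print_prob P p xs (?s + 31, R', q @ [R r])"
        using at[of 0 R'] print_prob_code[OF code[OF True], of 1 p xs R' "q @ [R r]"] z regs_i same[of r] Output by simp
      then show ?thesis
        using Suc.IH[OF Suc.prems, of "Suc i" "q @ [R r]"] Output True unfolding after by simp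
    next
      case (Flip r)
      then have r: "r < N" using regs_i by simp
      have coin: "code_at P ?s (fair_coin (N + 1) ?s r)"
        and jump: "code_at P (?s + 7) [JumpIfZero (N + 1) (?s + 31)]"
        using code[OF True] by (simp_all add: Flip code_at_append)
      have "print_prob P p xs (?s, R', q) = mix (1/2) (\<lambda>b. print_prob P p xs (?s + 7, R'(r := of_bool b), q))"
        by (rule fair_coin_correct[OF coin p]) (use z r in auto)
      also have "\<dots> = mix (1/2) (\<lambda>b. print_prob P p xs (?s + 31, R'(r := of_bool b), q))"
      proof (intro arg_cong2[where f = mix] refl ext)
        fix b
        show "print_prob P p xs (?s + 7, R'(r := of_bool b), q) = print_prob P p xs (?s + 31, R'(r := of_bool b), q)"
          using print_prob_code[OF jump, of 0 p xs "R'(r := of_bool b)" q] z r by simp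
      qed
      finally show ?thesis
        using Flip True by (simp add: mix_mono upd[OF r])
    next
      case (Input r)
      then have r: "r < N" using regs_i by simp
      have "bag_mix \<beta> (\<lambda>u \<beta>'. mix p (\<lambda>g. ?v \<beta>' (Suc i, R(r := of_bool (u \<and> g)), q))) \<le> print_prob P p xs (?s, R', q)"
      proof (rule bag_call_code_correct[where X = "\<lambda>v \<beta>'. ?v \<beta>' (Suc i, R(r := of_bool v), q)", OF _ p r Suc.prems])
        show "code_at P ?s (bag_call_code N ?s r)"
          using code[OF True] by (simp add: Input)
        show "?v \<beta> (Suc i, R(r := of_bool v), q) \<le> print_prob P p xs (?s + 31, R', q)"
          if "represents N \<beta> (R(r := of_bool v)) R'" for v \<beta> R'
          using Suc.IH[OF that, of "Suc i" q] unfolding after .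
      qed
      then show ?thesis using Input True by simp
    qed
  qed
qed

text \<open>
  The code \<open>pre\<close> is executed before the emulation proper. The padding is never reached, because every
  block ends with a jump.
\<close>

definition emulator :: "instr list \<Rightarrow> nat \<Rightarrow> program \<Rightarrow> program" where
  "emulator pre N M = pre @ concat (map (\<lambda>i.
     let b = block N (length pre) (length pre + 31 * i) (M ! i)
     in b @ replicate (31 - length b) (Const 0 0)) [0..<length M])"

lemma length_block: "length (block N off s I) \<le> 31"
  by (cases I) (simp_all add: bag_call_code_def bag_call_head_def bag_call_lookup_def bag_call_tail_def)

lemma Flip_notin_block: "Flip r \<notin> set (block N off s I)"
  by (cases I) (auto simp: fair_coin_def bag_call_code_def bag_call_head_def bag_call_lookup_def bag_call_tail_def)

lemma code_at_concat:
  assumes "\<And>i. i < n \<Longrightarrow> length (f i) = L" "i < n"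
  shows "code_at (pre @ concat (map f [0..<n])) (length pre + L * i) (f i)"
proof -
  have len: "length (concat (map f [0..<k])) = L * k" if "k \<le> n" for k
    using that assms(1) by (induction k) auto
  have "[0..<n] = [0..<i] @ i # [Suc i..<n]"
    using assms(2) by (metis le0 less_imp_le_nat upt_add_eq_append upt_conv_Cons le_add_diff_inverse)
  then have eq: "pre @ concat (map f [0..<n]) = (pre @ concat (map f [0..<i])) @ f i @ concat (map f [Suc i..<n])"
    by simp
  show ?thesis unfolding eq
    using len[of i] assms(2) by (auto simp: code_at_def nth_append)
qed

lemma length_emulator: "length (emulator pre N M) = length pre + 31 * length M"
proof -
  have "length (concat (map f [0..<n])) = 31 * n" if "\<And>i. length (f i) = 31" for f :: "nat \<Rightarrow> instr list" and n
    using that by (induction n) auto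
  then show ?thesis
    using length_block by (simp add: emulator_def Let_def)
qed

lemma emulator_code:
  assumes "i < length M"
  shows "code_at (emulator pre N M) (length pre + 31 * i) (block N (length pre) (length pre + 31 * i) (M ! i))"
proof -
  have "code_at (emulator pre N M) (length pre + 31 * i)
      (let b = block N (length pre) (length pre + 31 * i) (M ! i) in b @ replicate (31 - length b) (Const 0 0))"
    unfolding emulator_def
    by (rule code_at_concat[OF _ assms, where L = 31]) (use length_block in \<open>simp add: Let_def\<close>)
  then show ?thesis by (simp add: Let_def code_at_append)
qed

lemma emulator_prefix: "code_at (emulator pre N M) 0 pre"
  by (simp add: emulator_def code_at_def nth_append)

lemma emulator_no_flip:
  assumes "\<And>r. Flip r \<notin> set pre"
  shows "Flip r \<notin> set (emulator pre N M)"
  using assms Flip_notin_block by (auto simp: emulator_def Let_def)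

lemma register_bound: "\<exists>N. \<forall>I\<in>set M. instr_regs I \<subseteq> {..<N}"
proof -
  have "finite (instr_regs I)" for I by (cases I) auto
  then have "finite (\<Union>I\<in>set M. instr_regs I)" by blast
  then obtain N where "\<forall>x\<in>(\<Union>I\<in>set M. instr_regs I). x < N"
    using finite_nat_set_iff_bounded by blast
  then show ?thesis by (intro exI[of _ N]) auto
qed

lemma emulator_print_prob:
  assumes p: "p \<in> {0<..<1}" and regs: "\<forall>I\<in>set M. instr_regs I \<subseteq> {..<N}"
    and R: "\<And>x. x \<le> N + 1 \<Longrightarrow> R x = 0"
  shows "bag_print_prob M p xs \<le> print_prob (emulator pre N M) p xs (length pre, R, [])"
proof -
  have "represents N Map.empty (\<lambda>_. 0) R"
    using R by (simp add: represents_def encodes_empty)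
  then have "bag_payoff M (prints M xs) 0 (\<lambda>_. 0) p n Map.empty (0, \<lambda>_. 0, [])
      \<le> print_prob (emulator pre N M) p xs (length pre + 31 * 0, R, [])" for n
    using regs by (intro emulation[OF p length_emulator emulator_code]) auto
  then show ?thesis unfolding bag_print_prob_def start_def by (intro SUP_least) simp
qed

text \<open>
  The bits that the machine with a bag obtains from flips are obtained from the generator instead, so the
  expected number of flips drops to 0, whatever it was before.
\<close>

lemma bag_weakly_realizes_imp_realizable:
  assumes "weakly_realizes bag_gamma_call M \<psi>"
  shows "realizable \<psi>"
proof -
  obtain N where N: "\<forall>I\<in>set M. instr_regs I \<subseteq> {..<N}" using register_bound by blast
  have wins: "bag_print_prob M l xs \<le> print_prob (emulator [] N M) l xs start" if "l \<in> {0<..<1}" for l xs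
    using emulator_print_prob[OF that N, of "\<lambda>_. 0" xs "[]"] by (simp add: start_def)
  have "realizes gamma_call (emulator [] N M) \<psi>"
  proof (rule realizesI_lower_bounds)
    show "Flip r \<notin> set (emulator [] N M)" for r
      by (rule emulator_no_flip) simp
    fix l :: real assume l: "l \<in> {0<..<1}"
    have \<psi>: "\<psi> l \<in> {0<..<1}" "bag_print_prob M l [1] = ennreal (\<psi> l)" "bag_print_prob M l [0] = ennreal (1 - \<psi> l)"
      using assms l unfolding bag_weakly_realizes_iff by auto
    show "\<psi> l \<in> {0<..<1}" by (rule \<psi>)
    show "ennreal (\<psi> l) \<le> print_prob (emulator [] N M) l [1] start"
      "ennreal (1 - \<psi> l) \<le> print_prob (emulator [] N M) l [0] start"
      using wins[OF l] by (simp_all add: \<psi>(2,3)[symmetric])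
  qed
  then show ?thesis unfolding realizable_def by blast
qed

text \<open>
  A first call to the generator decides whether to start the emulation or to print 0 at once; the
  probability of printing 1 is thus multiplied by the parameter.
\<close>

lemma bag_weakly_realizes_imp_realizable_times:
  assumes "weakly_realizes bag_gamma_call M \<psi>"
  shows "realizable (\<lambda>l. l * \<psi> l)"
proof -
  obtain N where N: "\<forall>I\<in>set M. instr_regs I \<subseteq> {..<N}" using register_bound by blast
  define pre where "pre = [Input (N + 2), JumpIfZero (N + 2) 3, JumpIfZero (N + 1) 5,
    Output (N + 1), JumpIfZero (N + 1) (5 + 31 * length M)]"
  let ?P = "emulator pre N M"
  let ?R = "\<lambda>b. (\<lambda>_. 0)(N + 2 := of_bool b)"
  have lower: "ennreal l * bag_print_prob M l xs + ennreal (1 - l) * of_bool (xs = [0]) \<le> print_prob ?P l xs start"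
    if l: "l \<in> {0<..<1}" for l xs
  proof -
    have len: "length pre = 5" by (simp add: pre_def)
    note at = print_prob_code[OF emulator_prefix[of pre N M], of _ l xs]
    have "print_prob ?P l xs start = mix l (\<lambda>b. print_prob ?P l xs (1, ?R b, []))"
      using at[of 0] by (simp add: pre_def start_def)
    also have "\<dots> = mix l (\<lambda>b. if b then print_prob ?P l xs (5, ?R b, []) else of_bool (xs = [0]))"
    proof (intro arg_cong2[where f = mix] refl ext)
      fix b
      show "print_prob ?P l xs (1, ?R b, []) = (if b then print_prob ?P l xs (5, ?R b, []) else of_bool (xs = [0]))"
      proof (cases b)
        case True
        then show ?thesis using at[of 1 "?R b" "[]"] at[of 2 "?R b" "[]"] by (simp add: pre_def)
      next
        case False
        have "print_prob ?P l xs (5 + 31 * length M, ?R b, [0]) = of_bool (xs = [0])"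
          by (subst print_prob_step) (auto simp: length_emulator len prints_def)
        then show ?thesis
          using False at[of 1 "?R b" "[]"] at[of 3 "?R b" "[]"] at[of 4 "?R b" "[0]"] by (simp add: pre_def)
      qed
    qed
    finally show ?thesis
      using emulator_print_prob[OF l N, of "?R True" xs pre] len
      by (auto simp: mix_def intro!: add_mono mult_left_mono)
  qed
  have "realizes gamma_call ?P (\<lambda>l. l * \<psi> l)"
  proof (rule realizesI_lower_bounds)
    show "Flip r \<notin> set ?P" for r
      by (rule emulator_no_flip) (simp add: pre_def)
    fix l :: real assume l: "l \<in> {0<..<1}"
    have \<psi>: "\<psi> l \<in> {0<..<1}" "bag_print_prob M l [1] = ennreal (\<psi> l)" "bag_print_prob M l [0] = ennreal (1 - \<psi> l)"
      using assms l unfolding bag_weakly_realizes_iff by auto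
    have "l * \<psi> l < 1 * 1" using l \<psi>(1) by (intro mult_strict_mono) auto
    then show "l * \<psi> l \<in> {0<..<1}" using l \<psi>(1) by simp
    show "ennreal (l * \<psi> l) \<le> print_prob ?P l [1] start"
      using lower[OF l, of "[1]"] l \<psi> by (simp add: ennreal_mult)
    have "ennreal (1 - l * \<psi> l) = ennreal (l * (1 - \<psi> l)) + ennreal (1 - l)"
      using l \<psi>(1) by (subst ennreal_plus[symmetric]) (auto simp: algebra_simps)
    then show "ennreal (1 - l * \<psi> l) \<le> print_prob ?P l [0] start"
      using lower[OF l, of "[0]"] l \<psi> by (simp add: ennreal_mult)
  qed
  then show ?thesis unfolding realizable_def by blast
qed

theorem theorem4p1:
  fixes M :: program and \<phi> :: "real \<Rightarrow> real"
  assumes "realizes gamma_call M \<phi>"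
  shows "weakly_realizes bag_gamma_call M (\<lambda>l. (1 / l) * (LBINT w=0..l. \<phi> w))
    \<and> (\<forall>l\<in>{0<..<1}.
         (\<integral>\<^sup>+ w\<in>{0<..<l}. (expected_flips gamma_call M w + expected_reads gamma_call M w) \<partial>lborel) < \<infinity>
         \<longrightarrow> expected_flips bag_gamma_call M l < \<infinity>)
    \<and> realizable (\<lambda>l. (1 / l) * (LBINT w=0..l. \<phi> w))
    \<and> realizable (\<lambda>l. LBINT w=0..l. \<phi> w)"
proof -
  let ?\<Phi> = "(\<lambda>l. (1 / l) * (LBINT w=0..l. \<phi> w)) :: real \<Rightarrow> real"
  have weak: "weakly_realizes bag_gamma_call M ?\<Phi>"
    using assms by (intro bag_weakly_realizes_average) (simp add: realizes_def)
  have cost: "expected_flips bag_gamma_call M l < \<infinity>"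
    if "l \<in> {0<..<1}"
      "(\<integral>\<^sup>+ w\<in>{0<..<l}. (expected_flips gamma_call M w + expected_reads gamma_call M w) \<partial>lborel) < \<infinity>" for l
    using expected_flips_bag_le[OF that(1), of M] that(2)
    by (auto intro: le_less_trans simp: ennreal_mult_less_top)
  have cong: "realizable g" if "realizable f" "\<And>l. l \<in> {0<..<1} \<Longrightarrow> f l = g l" for f g
    using that unfolding realizable_def realizes_def weakly_realizes_def by simp
  have "realizable (\<lambda>l. LBINT w=0..l. \<phi> w)"
    by (rule cong[OF bag_weakly_realizes_imp_realizable_times[OF weak]]) auto
  then show ?thesis
    using weak cost bag_weakly_realizes_imp_realizable[OF weak] by blast
qed

end
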